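(* Let $p>3$ be a prime and $a,b\in\mathbb{Q}_p$ nonzero. Write $a=a^{*}/|a|_p$, $b=b^{*}/|b|_p$ with $a^{*},b^{*}\in\mathbb{Z}_p^{*}$ having first digits $a_0,b_0\in\{1,\dots,p-1\}$. Set $D_0=-4a_0^3-27b_0^2$, integers $u_1=0,u_2=-a_0,u_3=b_0$, $u_{n+3}=b_0u_n-a_0u_{n+1}$, and $D=-4(a|a|_p)^3-27(b|b|_p)^2$; when $D\neq0$ write $D=D^{*}/|D|_p$ with $D^{*}\in\mathbb{Z}_p^{*}$ having first digit $d_0$. When $-3d_0$ is a quadratic residue mod $p$, let $\Delta_0\in\{1,\dots,p-1\}$ with $\Delta_0^2\equiv-3d_0\pmod p$. Then the Cardano method is applicable to $x^3+ax=b$ in $\mathbb{Q}_p$, i.e. the expression $$x=\sqrt[3]{\tfrac{b}{2}+\sqrt{\left(\tfrac{a}{3}\right)^3+\left(\tfrac{b}{2}\right)^2}}+\sqrt[3]{\tfrac{b}{2}-\sqrt{\left(\tfrac{a}{3}\right)^3+\left(\tfrac{b}{2}\right)^2}}$$ is well defined in $\mathbb{Q}_p$ (the square root and both cube roots exist in $\mathbb{Q}_p$) and gives a solution of $x^3+ax=b$, if and only if one of the following holds: (I.1) $|a|_p^3<|b|_p^2$, $3\mid\log_p|b|_p$, and $b_0^{\frac{p-1}{(3,p-1)}}\equiv1\pmod p$; (I.2) $|a|_p^3=|b|_p^2$, $D=0$, and $(4b_0)^{\frac{p-1}{(3,p-1)}}\equiv1\pmod p$; (I.3) $|a|_p^3=|b|_p^2$,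 $0<|D|_p<1$, $2\mid\log_p|D|_p$, $(-3d_0)^{\frac{p-1}{2}}\equiv1\pmod p$, and $(4b_0)^{\frac{p-1}{(3,p-1)}}\equiv1\pmod p$; (I.4) $|a|_p^3=|b|_p^2$, $|D|_p=1$, $D_0u_{p-2}^2\not\equiv 9a_0^2\pmod p$, $(-3d_0)^{\frac{p-1}{2}}\equiv1\pmod p$, and $(108b_0+12\Delta_0)^{\frac{p-1}{(3,p-1)}}\equiv1\pmod p$; (I.5) $|a|_p^3>|b|_p^2$, $2\mid\log_p|a|_p$, and $(3a_0)^{\frac{p-1}{2}}\equiv1\pmod p$.
   Context: $\mathbb{Q}_p$ is the field of $p$-adic numbers with absolute value $|\cdot|_p$, $\mathbb{Z}_p^{*}=\{|x|_p=1\}$. Every nonzero $x\in\mathbb{Q}_p$ is uniquely $x=x^{*}/|x|_p$ with $x^{*}\in\mathbb{Z}_p^{*}$, whose canonical expansion $x_0+x_1p+\cdots$ has first digit $x_0\in\{1,\dots,p-1\}$. $\log_p|c|_p=-\mathrm{ord}_p(c)$. $(m,n)$ denotes the gcd. *)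

theory Defs
  imports
    "HOL-Analysis.Analysis"
    "HOL-Number_Theory.Number_Theory"
    "Berlekamp_Zassenhaus.Finite_Field"
begin

section \<open>The \<open>p\<close>-adic absolute value on the rationals\<close>

definition rat_pval :: "nat \<Rightarrow> rat \<Rightarrow> int" where
  "rat_pval p q = int (multiplicity (int p) (fst (quotient_of q)))
                - int (multiplicity (int p) (snd (quotient_of q)))"

definition rat_pabs :: "nat \<Rightarrow> rat \<Rightarrow> rat" where
  "rat_pabs p q = (if q = 0 then 0 else of_nat p powi (- rat_pval p q))"

lemma rat_as_of_int_divide:
  fixes q :: rat
  obtains a b :: int where "q = of_int a / of_int b" "b \<noteq> 0"
proof -
  obtain a b where ab: "quotient_of q = (a, b)" by (cases "quotient_of q") auto
  show ?thesis
    using that[of a b] quotient_of_div[OF ab] quotient_of_denom_pos[OF ab] by simp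
qed

lemma rat_pabs_0 [simp]: "rat_pabs p 0 = 0"
  by (simp add: rat_pabs_def)

context
  fixes p :: nat
  assumes p: "prime p"
begin

lemma rat_pval_of_int_divide:
  assumes "a \<noteq> 0" "b \<noteq> 0"
  shows "rat_pval p (of_int a / of_int b)
       = int (multiplicity (int p) a) - int (multiplicity (int p) b)"
proof -
  obtain c d where cd: "quotient_of (of_int a / of_int b) = (c, d)"
    by (cases "quotient_of (of_int a / of_int b)") auto
  have d: "d > 0" using quotient_of_denom_pos[OF cd] .
  have eq: "of_int a / of_int b = (of_int c / of_int d :: rat)"
    using quotient_of_div[OF cd] .
  then have "of_int (a * d) = (of_int (c * b) :: rat)"
    using assms d by (simp add: field_simps)
  then have ad: "a * d = c * b" by (simp only: of_int_eq_iff)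
  then have c: "c \<noteq> 0" using assms d by auto
  have pe: "prime_elem (int p)" using p by simp
  have "multiplicity (int p) a + multiplicity (int p) d
      = multiplicity (int p) c + multiplicity (int p) b"
    using ad prime_elem_multiplicity_mult_distrib[OF pe] assms c d
    by (metis less_irrefl)
  then show ?thesis by (simp add: rat_pval_def cd)
qed

lemma rat_pabs_nonneg [simp]: "rat_pabs p q \<ge> 0"
  by (simp add: rat_pabs_def)

lemma rat_pabs_pos: "q \<noteq> 0 \<Longrightarrow> rat_pabs p q > 0"
  using p by (simp add: rat_pabs_def prime_gt_0_nat)

lemma rat_pabs_eq_0_iff [simp]: "rat_pabs p q = 0 \<longleftrightarrow> q = 0"
  using rat_pabs_pos[of q] by force

lemma rat_pval_mult:
  assumes "x \<noteq> 0" "y \<noteq> 0"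
  shows "rat_pval p (x * y) = rat_pval p x + rat_pval p y"
proof -
  obtain a b where x: "x = of_int a / of_int b" "b \<noteq> 0" by (rule rat_as_of_int_divide)
  obtain c d where y: "y = of_int c / of_int d" "d \<noteq> 0" by (rule rat_as_of_int_divide)
  have nz: "a \<noteq> 0" "c \<noteq> 0" using x y assms by auto
  have xy: "x * y = of_int (a * c) / of_int (b * d)" by (simp add: x y)
  have pe: "prime_elem (int p)" using p by simp
  have "rat_pval p (x * y)
      = int (multiplicity (int p) (a * c)) - int (multiplicity (int p) (b * d))"
    unfolding xy using nz x(2) y(2) by (intro rat_pval_of_int_divide) auto
  also have "\<dots> = rat_pval p x + rat_pval p y"
    unfolding x(1) y(1) rat_pval_of_int_divide[OF nz(1) x(2)] rat_pval_of_int_divide[OF nz(2) y(2)]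
      prime_elem_multiplicity_mult_distrib[OF pe nz]
      prime_elem_multiplicity_mult_distrib[OF pe x(2) y(2)] by simp
  finally show ?thesis .
qed

lemma rat_pabs_mult: "rat_pabs p (x * y) = rat_pabs p x * rat_pabs p y"
proof (cases "x = 0 \<or> y = 0")
  case False
  moreover have "of_nat p powi (- v + - w) = (of_nat p powi (- v) * of_nat p powi (- w) :: rat)" for v w
    using p by (intro power_int_add) auto
  ultimately show ?thesis
    by (auto simp: rat_pabs_def rat_pval_mult)
qed auto

lemma rat_pabs_1 [simp]: "rat_pabs p 1 = 1"
  using rat_pval_of_int_divide[of 1 1] by (simp add: rat_pabs_def)

lemma rat_pabs_minus [simp]: "rat_pabs p (- x) = rat_pabs p x"
proof -
  have "rat_pval p (-1) = 0"
    using rat_pval_of_int_divide[of "-1" 1] by (simp add: multiplicity_unit_right)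
  then have "rat_pabs p (-1) = 1" by (simp add: rat_pabs_def)
  then show ?thesis using rat_pabs_mult[of "-1" x] by simp
qed

lemma rat_pabs_inverse: "rat_pabs p (inverse x) = inverse (rat_pabs p x)"
proof (cases "x = 0")
  case False
  then have "rat_pabs p x * rat_pabs p (inverse x) = 1"
    unfolding rat_pabs_mult[symmetric] by simp
  then show ?thesis by (metis inverse_unique)
qed auto

lemma rat_pabs_minus_commute: "rat_pabs p (x - y) = rat_pabs p (y - x)"
  using rat_pabs_minus[of "x - y"] by simp

lemma rat_pabs_ultrametric: "rat_pabs p (x + y) \<le> max (rat_pabs p x) (rat_pabs p y)"
proof (cases "x = 0 \<or> y = 0 \<or> x + y = 0")
  case True
  then show ?thesis by (auto simp: le_max_iff_disj)
next
  case False
  obtain a b where x: "x = of_int a / of_int b" "b \<noteq> 0" by (rule rat_as_of_int_divide)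
  obtain c d where y: "y = of_int c / of_int d" "d \<noteq> 0" by (rule rat_as_of_int_divide)
  define m where "m = a * d"
  define n where "n = c * b"
  define e where "e = b * d"
  have e: "e \<noteq> 0" using x y by (simp add: e_def)
  have xe: "x = of_int m / of_int e" and ye: "y = of_int n / of_int e"
    using x y by (simp_all add: m_def n_def e_def)
  have xye: "x + y = of_int (m + n) / of_int e"
    using xe ye by (simp add: add_divide_distrib)
  have nz: "m \<noteq> 0" "n \<noteq> 0" "m + n \<noteq> 0" using False xe ye xye by auto
  define k where "k = min (multiplicity (int p) m) (multiplicity (int p) n)"
  have "int p ^ k dvd m + n"
    by (intro dvd_add multiplicity_dvd') (auto simp: k_def)
  then have "k \<le> multiplicity (int p) (m + n)"
    using nz p by (intro multiplicity_geI) auto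
  then have "min (rat_pval p x) (rat_pval p y) \<le> rat_pval p (x + y)"
    unfolding xye unfolding xe ye using nz e
    by (simp add: rat_pval_of_int_divide k_def del: of_int_add)
  then consider "rat_pval p x \<le> rat_pval p (x + y)" | "rat_pval p y \<le> rat_pval p (x + y)"
    by linarith
  then show ?thesis
  proof cases
    case 1
    then have "rat_pabs p (x + y) \<le> rat_pabs p x"
      using False p prime_ge_1_nat[OF p] by (auto simp: rat_pabs_def intro!: power_int_increasing)
    then show ?thesis by simp
  next
    case 2
    then have "rat_pabs p (x + y) \<le> rat_pabs p y"
      using False p prime_ge_1_nat[OF p] by (auto simp: rat_pabs_def intro!: power_int_increasing)
    then show ?thesis by simp
  qed
qed

lemma rat_pabs_ultrametric_less:
  "rat_pabs p x < r \<Longrightarrow> rat_pabs p y < r \<Longrightarrow> rat_pabs p (x + y) < r"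
  using rat_pabs_ultrametric[of x y] by linarith

lemma rat_pabs_eqI:
  assumes "rat_pabs p (x - y) < rat_pabs p y"
  shows "rat_pabs p x = rat_pabs p y"
proof -
  have "rat_pabs p x \<le> max (rat_pabs p (x - y)) (rat_pabs p y)"
    using rat_pabs_ultrametric[of "x - y" y] by simp
  moreover have "rat_pabs p y \<le> max (rat_pabs p (x - y)) (rat_pabs p x)"
    using rat_pabs_ultrametric[of "y - x" x] rat_pabs_minus_commute[of x y] by simp
  ultimately show ?thesis using assms by (simp add: max_def split: if_splits)
qed

end


section \<open>Cauchy sequences and null sequences for the \<open>p\<close>-adic absolute value\<close>

definition pvanishes :: "nat \<Rightarrow> (nat \<Rightarrow> rat) \<Rightarrow> bool" where
  "pvanishes p X \<longleftrightarrow> (\<forall>r>0. \<exists>k. \<forall>n\<ge>k. rat_pabs p (X n) < r)"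

definition pcauchy :: "nat \<Rightarrow> (nat \<Rightarrow> rat) \<Rightarrow> bool" where
  "pcauchy p X \<longleftrightarrow> (\<forall>r>0. \<exists>k. \<forall>m\<ge>k. \<forall>n\<ge>k. rat_pabs p (X m - X n) < r)"

definition padic_rel :: "'p::prime_card itself \<Rightarrow> (nat \<Rightarrow> rat) \<Rightarrow> (nat \<Rightarrow> rat) \<Rightarrow> bool" where
  "padic_rel _ X Y \<longleftrightarrow> pcauchy CARD('p) X \<and> pcauchy CARD('p) Y
     \<and> pvanishes CARD('p) (\<lambda>n. X n - Y n)"

context
  fixes p :: nat
  assumes p: "prime p"
begin

lemma pvanishes_0 [simp]: "pvanishes p (\<lambda>n. 0)"
  by (simp add: pvanishes_def)

lemma pvanishes_const_iff [simp]: "pvanishes p (\<lambda>n. c) \<longleftrightarrow> c = 0"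
  using rat_pabs_pos[OF p, of c] by (cases "c = 0") (auto simp: pvanishes_def)

lemma pvanishes_minus: "pvanishes p X \<Longrightarrow> pvanishes p (\<lambda>n. - X n)"
  by (simp add: pvanishes_def p)

lemma pvanishes_add:
  assumes "pvanishes p X" "pvanishes p Y"
  shows "pvanishes p (\<lambda>n. X n + Y n)"
  unfolding pvanishes_def
proof (intro allI impI)
  fix r :: rat assume "r > 0"
  then obtain k l where "\<forall>n\<ge>k. rat_pabs p (X n) < r" "\<forall>n\<ge>l. rat_pabs p (Y n) < r"
    using assms unfolding pvanishes_def by blast
  then show "\<exists>k. \<forall>n\<ge>k. rat_pabs p (X n + Y n) < r"
    by (intro exI[of _ "max k l"]) (auto intro: rat_pabs_ultrametric_less[OF p])
qed

lemma pvanishes_diff: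
  "pvanishes p X \<Longrightarrow> pvanishes p Y \<Longrightarrow> pvanishes p (\<lambda>n. X n - Y n)"
  using pvanishes_add[of X "\<lambda>n. - Y n"] pvanishes_minus[of Y] by simp

lemma pcauchy_const [simp]: "pcauchy p (\<lambda>n. c)"
  by (simp add: pcauchy_def)

lemma pcauchy_minus: "pcauchy p X \<Longrightarrow> pcauchy p (\<lambda>n. - X n)"
  unfolding pcauchy_def by (simp add: rat_pabs_minus_commute[OF p])

lemma pcauchy_add:
  assumes "pcauchy p X" "pcauchy p Y"
  shows "pcauchy p (\<lambda>n. X n + Y n)"
  unfolding pcauchy_def
proof (intro allI impI)
  fix r :: rat assume "r > 0"
  then obtain k l where "\<forall>m\<ge>k. \<forall>n\<ge>k. rat_pabs p (X m - X n) < r"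
      "\<forall>m\<ge>l. \<forall>n\<ge>l. rat_pabs p (Y m - Y n) < r"
    using assms unfolding pcauchy_def by blast
  then show "\<exists>k. \<forall>m\<ge>k. \<forall>n\<ge>k. rat_pabs p (X m + Y m - (X n + Y n)) < r"
    by (intro exI[of _ "max k l"]) (auto simp: add_diff_add intro!: rat_pabs_ultrametric_less[OF p])
qed

lemma pcauchy_bounded:
  assumes "pcauchy p X"
  obtains b where "b > 0" "\<And>n. rat_pabs p (X n) < b"
proof -
  obtain k where k: "\<And>m n. m \<ge> k \<Longrightarrow> n \<ge> k \<Longrightarrow> rat_pabs p (X m - X n) < 1"
    using assms zero_less_one unfolding pcauchy_def by blast
  define M where "M = Max ((\<lambda>n. rat_pabs p (X n)) ` {..k})"
  have M: "rat_pabs p (X n) \<le> M" if "n \<le> k" for n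
    unfolding M_def using that by (intro Max_ge) auto
  have M0: "M \<ge> 0" using M[of 0] rat_pabs_nonneg[OF p, of "X 0"] by linarith
  have "rat_pabs p (X n) < M + 1" for n
  proof (cases "n \<le> k")
    case True
    then show ?thesis using M[of n] by simp
  next
    case False
    then have "rat_pabs p ((X n - X k) + X k) \<le> max (rat_pabs p (X n - X k)) (rat_pabs p (X k))"
      by (intro rat_pabs_ultrametric p)
    moreover have "rat_pabs p (X n - X k) < 1" using False by (intro k) auto
    ultimately show ?thesis using M[of k] M0 by simp
  qed
  then show ?thesis using that[of "M + 1"] M0 by simp
qed

lemma pvanishes_mult:
  assumes "pcauchy p X" "pvanishes p Y"
  shows "pvanishes p (\<lambda>n. X n * Y n)"
  unfolding pvanishes_def
proof (intro allI impI)
  fix r :: rat assume r: "r > 0"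
  obtain b where b: "b > 0" "\<And>n. rat_pabs p (X n) < b"
    using pcauchy_bounded[OF assms(1)] by blast
  obtain k where k: "\<forall>n\<ge>k. rat_pabs p (Y n) < r / b"
    using assms(2) b r unfolding pvanishes_def by (meson divide_pos_pos)
  have "rat_pabs p (X n * Y n) < r" if "n \<ge> k" for n
  proof -
    have "rat_pabs p (X n) * rat_pabs p (Y n) < b * (r / b)"
      using b k that by (intro mult_strict_mono') (auto simp: p)
    then show ?thesis using b by (simp add: rat_pabs_mult[OF p])
  qed
  then show "\<exists>k. \<forall>n\<ge>k. rat_pabs p (X n * Y n) < r" by blast
qed

lemma pcauchy_mult:
  assumes "pcauchy p X" "pcauchy p Y"
  shows "pcauchy p (\<lambda>n. X n * Y n)"
  unfolding pcauchy_def
proof (intro allI impI)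
  fix r :: rat assume r: "r > 0"
  obtain b where b: "b > 0" "\<And>n. rat_pabs p (X n) < b"
    using pcauchy_bounded[OF assms(1)] by blast
  obtain c where c: "c > 0" "\<And>n. rat_pabs p (Y n) < c"
    using pcauchy_bounded[OF assms(2)] by blast
  obtain k where k: "\<forall>m\<ge>k. \<forall>n\<ge>k. rat_pabs p (X m - X n) < r / c"
    using assms(1) c r unfolding pcauchy_def by (meson divide_pos_pos)
  obtain l where l: "\<forall>m\<ge>l. \<forall>n\<ge>l. rat_pabs p (Y m - Y n) < r / b"
    using assms(2) b r unfolding pcauchy_def by (meson divide_pos_pos)
  have "rat_pabs p (X m * Y m - X n * Y n) < r" if "m \<ge> max k l" "n \<ge> max k l" for m n
  proof -
    have "rat_pabs p (X m) * rat_pabs p (Y m - Y n) < b * (r / b)"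
      using b l that by (intro mult_strict_mono') (auto simp: p)
    moreover have "rat_pabs p (X m - X n) * rat_pabs p (Y n) < r / c * c"
      using c k that by (intro mult_strict_mono') (auto simp: p)
    ultimately show ?thesis
      unfolding mult_diff_mult using b c
      by (intro rat_pabs_ultrametric_less[OF p]) (simp_all add: rat_pabs_mult[OF p])
  qed
  then show "\<exists>k. \<forall>m\<ge>k. \<forall>n\<ge>k. rat_pabs p (X m * Y m - X n * Y n) < r" by blast
qed

lemma pcauchy_rat_pabs_eventually_const:
  assumes "pcauchy p X" "\<not> pvanishes p X"
  obtains c where "c > 0" "\<forall>\<^sub>F n in sequentially. rat_pabs p (X n) = c"
proof -
  obtain r where r: "r > 0" "\<And>k. \<exists>n\<ge>k. rat_pabs p (X n) \<ge> r"
    using assms(2) unfolding pvanishes_def by (meson not_less)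
  obtain k where k: "\<forall>m\<ge>k. \<forall>n\<ge>k. rat_pabs p (X m - X n) < r"
    using assms(1) r unfolding pcauchy_def by blast
  obtain l where l: "l \<ge> k" "rat_pabs p (X l) \<ge> r" using r by blast
  have "rat_pabs p (X n) = rat_pabs p (X l)" if "n \<ge> k" for n
    by (rule rat_pabs_eqI[OF p]) (use k l that in \<open>meson less_le_trans\<close>)
  then have "\<forall>\<^sub>F n in sequentially. rat_pabs p (X n) = rat_pabs p (X l)"
    unfolding eventually_sequentially by blast
  then show ?thesis using that l r by (meson less_le_trans)
qed

lemma pvanishes_inverse_diff:
  assumes "pcauchy p X" "\<not> pvanishes p X" "pcauchy p Y" "\<not> pvanishes p Y"
    and "pvanishes p (\<lambda>n. X n - Y n)"
  shows "pvanishes p (\<lambda>n. inverse (X n) - inverse (Y n))"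
  unfolding pvanishes_def
proof (intro allI impI)
  fix r :: rat assume r: "r > 0"
  obtain c where c: "c > 0" "\<forall>\<^sub>F n in sequentially. rat_pabs p (X n) = c"
    using assms(1,2) by (rule pcauchy_rat_pabs_eventually_const)
  obtain d where d: "d > 0" "\<forall>\<^sub>F n in sequentially. rat_pabs p (Y n) = d"
    using assms(3,4) by (rule pcauchy_rat_pabs_eventually_const)
  have "c * r * d > 0" using c d r by simp
  then have "\<forall>\<^sub>F n in sequentially. rat_pabs p (X n - Y n) < c * r * d"
    using assms(5) unfolding pvanishes_def eventually_sequentially by blast
  with c(2) d(2) have "\<forall>\<^sub>F n in sequentially. rat_pabs p (inverse (X n) - inverse (Y n)) < r"
  proof eventually_elim
    case (elim n)
    then have "X n \<noteq> 0" "Y n \<noteq> 0" using c d by auto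
    then have "rat_pabs p (inverse (X n) - inverse (Y n)) = inverse c * rat_pabs p (X n - Y n) * inverse d"
      using elim by (simp add: inverse_diff_inverse rat_pabs_mult[OF p] rat_pabs_inverse[OF p] p
          rat_pabs_minus_commute[OF p, of "Y n"])
    also have "\<dots> < r" using elim c d by (simp add: field_simps)
    finally show ?case .
  qed
  then show "\<exists>k. \<forall>n\<ge>k. rat_pabs p (inverse (X n) - inverse (Y n)) < r"
    by (simp add: eventually_sequentially)
qed

lemma pcauchy_inverse:
  assumes "pcauchy p X" "\<not> pvanishes p X"
  shows "pcauchy p (\<lambda>n. inverse (X n))"
  unfolding pcauchy_def
proof (intro allI impI)
  fix r :: rat assume r: "r > 0"
  obtain c where c: "c > 0" "\<forall>\<^sub>F n in sequentially. rat_pabs p (X n) = c"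
    using assms by (rule pcauchy_rat_pabs_eventually_const)
  obtain k where k: "\<forall>n\<ge>k. rat_pabs p (X n) = c"
    using c by (auto simp: eventually_sequentially)
  have "c * r * c > 0" using c r by simp
  then obtain l where l: "\<forall>m\<ge>l. \<forall>n\<ge>l. rat_pabs p (X m - X n) < c * r * c"
    using assms(1) unfolding pcauchy_def by blast
  have "rat_pabs p (inverse (X m) - inverse (X n)) < r"
    if "m \<ge> max k l" "n \<ge> max k l" for m n
  proof -
    have e: "rat_pabs p (X m) = c" "rat_pabs p (X n) = c" "rat_pabs p (X m - X n) < c * r * c"
      using k l that by auto
    then have "X m \<noteq> 0" "X n \<noteq> 0" using c by auto
    then have "rat_pabs p (inverse (X m) - inverse (X n))
             = inverse c * rat_pabs p (X m - X n) * inverse c"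
      using e by (simp add: inverse_diff_inverse rat_pabs_mult[OF p] rat_pabs_inverse[OF p] p
          rat_pabs_minus_commute[OF p, of "X n"])
    also have "\<dots> < r" using e c by (simp add: field_simps)
    finally show ?thesis .
  qed
  then show "\<exists>k. \<forall>m\<ge>k. \<forall>n\<ge>k. rat_pabs p (inverse (X m) - inverse (X n)) < r" by blast
qed

lemma pvanishes_cong:
  assumes "pvanishes p (\<lambda>n. X n - Y n)"
  shows "pvanishes p X \<longleftrightarrow> pvanishes p Y"
proof
  show "pvanishes p Y" if "pvanishes p X"
    using pvanishes_diff[OF that assms] by simp
  show "pvanishes p X" if "pvanishes p Y"
    using pvanishes_add[OF assms that] by simp
qed

end


section \<open>The field of \<open>p\<close>-adic numbers\<close>

text \<open>
  The prime \<open>p\<close> is the cardinality of the type parameter, and the field is the completion of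
  the rationals for the \<open>p\<close>-adic absolute value: Cauchy sequences modulo null sequences.
\<close>

lemma pcard [simp]: "prime CARD('p::prime_card)"
  by (rule prime_card)

lemma part_equivp_padic_rel: "part_equivp (padic_rel TYPE('p::prime_card))"
proof (rule part_equivpI)
  show "\<exists>X. padic_rel TYPE('p) X X"
    by (rule exI[of _ "\<lambda>_. 0"]) (simp add: padic_rel_def)
  show "symp (padic_rel TYPE('p))"
    using pvanishes_minus[OF pcard[where 'p='p]] by (fastforce intro!: sympI simp: padic_rel_def)
  show "transp (padic_rel TYPE('p))"
  proof (rule transpI)
    fix X Y Z assume "padic_rel TYPE('p) X Y" "padic_rel TYPE('p) Y Z"
    then show "padic_rel TYPE('p) X Z"
      using pvanishes_add[OF pcard[where 'p='p], of "\<lambda>n. X n - Y n" "\<lambda>n. Y n - Z n"]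
      by (simp add: padic_rel_def)
  qed
qed

typedef (overloaded) ('p::prime_card) padic =
  "{c. \<exists>X. padic_rel TYPE('p) X X \<and> c = Collect (padic_rel TYPE('p) X)}"
  using part_equivp_padic_rel by (auto elim!: part_equivpE)

definition padic_class :: "(nat \<Rightarrow> rat) \<Rightarrow> 'p::prime_card padic" where
  "padic_class = quot_type.abs (padic_rel TYPE('p)) Abs_padic"

definition padic_repr :: "'p::prime_card padic \<Rightarrow> nat \<Rightarrow> rat" where
  "padic_repr = quot_type.rep Rep_padic"

definition cr_padic :: "(nat \<Rightarrow> rat) \<Rightarrow> 'p::prime_card padic \<Rightarrow> bool" where
  "cr_padic X y \<longleftrightarrow> padic_rel TYPE('p) X X \<and> padic_class X = y"

lemma quot_type_padic:
  "quot_type (padic_rel TYPE('p::prime_card)) (Abs_padic :: _ \<Rightarrow> 'p padic) Rep_padic"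
  using type_definition_padic[where 'p = 'p] part_equivp_padic_rel[where 'p = 'p]
  by (intro quot_type.intro)
    (auto simp: Rep_padic_inverse Rep_padic_inject Abs_padic_inverse dest: type_definition.Rep)

lemma Quotient_padic:
  "Quotient (padic_rel TYPE('p::prime_card)) padic_class padic_repr (cr_padic :: _ \<Rightarrow> 'p padic \<Rightarrow> _)"
  using Quotient3_to_Quotient[OF quot_type.Quotient[OF quot_type_padic[where 'p = 'p]] reflexive]
  unfolding padic_class_def[symmetric] padic_repr_def[symmetric] cr_padic_def[abs_def, symmetric] .

setup_lifting Quotient_padic

lemma padic_rel_refl: "padic_rel TYPE('p::prime_card) X X \<longleftrightarrow> pcauchy CARD('p) X"
  by (simp add: padic_rel_def)

instantiation padic :: (prime_card) field
begin

lift_definition zero_padic :: "'a padic" is "\<lambda>_. 0"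
  by (simp add: padic_rel_def)

lift_definition one_padic :: "'a padic" is "\<lambda>_. 1"
  by (simp add: padic_rel_def)

lift_definition plus_padic :: "'a padic \<Rightarrow> 'a padic \<Rightarrow> 'a padic" is "\<lambda>X Y n. X n + Y n"
  unfolding padic_rel_def by (simp add: add_diff_add pcauchy_add pvanishes_add)

lift_definition uminus_padic :: "'a padic \<Rightarrow> 'a padic" is "\<lambda>X n. - X n"
  unfolding padic_rel_def minus_diff_minus by (simp add: pcauchy_minus pvanishes_minus del: minus_diff_eq)

lift_definition times_padic :: "'a padic \<Rightarrow> 'a padic \<Rightarrow> 'a padic" is "\<lambda>X Y n. X n * Y n"
proof -
  fix X Y Z W
  assume *: "padic_rel TYPE('a) X Y" "padic_rel TYPE('a) Z W"
  then have "pvanishes CARD('a) (\<lambda>n. X n * (Z n - W n) + W n * (X n - Y n))"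
    unfolding padic_rel_def by (intro pvanishes_add pvanishes_mult) auto
  also have "(\<lambda>n. X n * (Z n - W n) + W n * (X n - Y n)) = (\<lambda>n. X n * Z n - Y n * W n)"
    by (simp add: algebra_simps)
  finally show "padic_rel TYPE('a) (\<lambda>n. X n * Z n) (\<lambda>n. Y n * W n)"
    using * by (simp add: padic_rel_def pcauchy_mult)
qed

lift_definition inverse_padic :: "'a padic \<Rightarrow> 'a padic"
  is "\<lambda>X. if pvanishes CARD('a) X then (\<lambda>n. 0) else (\<lambda>n. inverse (X n))"
proof -
  fix X Y assume *: "padic_rel TYPE('a) X Y"
  then have v: "pvanishes CARD('a) X \<longleftrightarrow> pvanishes CARD('a) Y"
    by (intro pvanishes_cong) (auto simp: padic_rel_def)
  show "padic_rel TYPE('a) (if pvanishes CARD('a) X then \<lambda>n. 0 else (\<lambda>n. inverse (X n)))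
            (if pvanishes CARD('a) Y then \<lambda>n. 0 else (\<lambda>n. inverse (Y n)))"
  proof (cases "pvanishes CARD('a) Y")
    case True
    then show ?thesis using v by (simp add: padic_rel_def)
  next
    case False
    then show ?thesis using v *
      by (simp add: padic_rel_def pcauchy_inverse pvanishes_inverse_diff)
  qed
qed

definition "x - y = x + - y" for x y :: "'a padic"

definition "x div y = x * inverse y" for x y :: "'a padic"

instance
proof
  fix a b c :: "'a padic"
  show "a + b + c = a + (b + c)"
    by transfer (simp add: padic_rel_def pcauchy_add add.assoc)
  show "a + b = b + a"
    by transfer (simp add: padic_rel_def pcauchy_add add.commute)
  show "0 + a = a"
    by transfer (simp add: padic_rel_def)
  show "- a + a = 0"
    by transfer (simp add: padic_rel_def)
  show "a - b = a + - b"
    by (rule minus_padic_def)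
  show "a * b * c = a * (b * c)"
    by transfer (simp add: padic_rel_def pcauchy_mult mult.assoc)
  show "a * b = b * a"
    by transfer (simp add: padic_rel_def pcauchy_mult mult.commute)
  show "1 * a = a"
    by transfer (simp add: padic_rel_def)
  show "(a + b) * c = a * c + b * c"
    by transfer (simp add: padic_rel_def pcauchy_mult pcauchy_add distrib_right)
  show "(0::'a padic) \<noteq> 1"
    by transfer (simp add: padic_rel_def)
  show "a div b = a * inverse b"
    by (rule divide_padic_def)
  show "inverse (0::'a padic) = 0"
    by transfer (simp add: padic_rel_def)
  show "inverse a * a = 1" if "a \<noteq> 0"
    using that
  proof transfer
    fix X assume X: "padic_rel TYPE('a) X X" "\<not> padic_rel TYPE('a) X (\<lambda>_. 0)"
    then have X': "pcauchy CARD('a) X" "\<not> pvanishes CARD('a) X"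
      by (auto simp: padic_rel_def)
    then obtain c where c: "c > 0" "\<forall>\<^sub>F n in sequentially. rat_pabs CARD('a) (X n) = c"
      using pcauchy_rat_pabs_eventually_const[OF pcard] by blast
    from c(2) have "\<forall>\<^sub>F n in sequentially. inverse (X n) * X n - 1 = 0"
    proof eventually_elim
      case (elim n)
      then have "X n \<noteq> 0" using c(1) by auto
      then show ?case by simp
    qed
    then obtain k where k: "\<forall>n\<ge>k. inverse (X n) * X n - 1 = 0"
      by (auto simp: eventually_sequentially)
    then have "pvanishes CARD('a) (\<lambda>n. inverse (X n) * X n - 1)"
      unfolding pvanishes_def by (metis rat_pabs_0)
    then show "padic_rel TYPE('a)
       (\<lambda>n. (if pvanishes CARD('a) X then \<lambda>n. 0 else (\<lambda>n. inverse (X n))) n * X n) (\<lambda>_. 1)"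
      using X' by (simp add: padic_rel_def pcauchy_mult pcauchy_inverse)
  qed
qed

end

lift_definition padic_of_rat :: "rat \<Rightarrow> 'p::prime_card padic" is "\<lambda>q _. q"
  by (simp add: padic_rel_def)

lemma padic_of_rat_add: "padic_of_rat (q + r) = padic_of_rat q + padic_of_rat r"
  by transfer (simp add: padic_rel_def)

lemma padic_of_rat_mult: "padic_of_rat (q * r) = padic_of_rat q * padic_of_rat r"
  by transfer (simp add: padic_rel_def)

lemma padic_of_rat_0: "padic_of_rat 0 = 0"
  by transfer (simp add: padic_rel_def)

lemma padic_of_rat_1: "padic_of_rat 1 = 1"
  by transfer (simp add: padic_rel_def)

lemma padic_of_nat_eq: "of_nat n = (padic_of_rat (of_nat n) :: 'p::prime_card padic)"
proof (induction n)
  case 0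
  show ?case by (simp only: of_nat_0 padic_of_rat_0)
next
  case (Suc n)
  show ?case by (simp only: of_nat_Suc padic_of_rat_add padic_of_rat_1 Suc.IH[symmetric])
qed

lemma padic_of_rat_eq_iff: "padic_of_rat q = (padic_of_rat r :: 'p::prime_card padic) \<longleftrightarrow> q = r"
  by transfer (simp add: padic_rel_def)

instance padic :: (prime_card) field_char_0
  by standard (auto intro!: injI simp: padic_of_nat_eq padic_of_rat_eq_iff)


section \<open>The absolute value and the metric\<close>

text \<open>
  Along a Cauchy sequence that is not null the absolute value is eventually constant.
  The absolute value is rational-valued, so that \<^term>\<open>of_rat\<close> maps it into the field.
\<close>

definition pseq_abs :: "nat \<Rightarrow> (nat \<Rightarrow> rat) \<Rightarrow> rat" where
  "pseq_abs p X = (if pvanishes p X then 0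
     else (THE c. \<forall>\<^sub>F n in sequentially. rat_pabs p (X n) = c))"

context
  fixes p :: nat
  assumes p: "prime p"
begin

lemma pseq_abs_eventually:
  assumes "pcauchy p X" "\<not> pvanishes p X"
  shows "pseq_abs p X > 0" "\<forall>\<^sub>F n in sequentially. rat_pabs p (X n) = pseq_abs p X"
proof -
  obtain c where c: "c > 0" "\<forall>\<^sub>F n in sequentially. rat_pabs p (X n) = c"
    using pcauchy_rat_pabs_eventually_const[OF p assms] .
  have "d = c" if "\<forall>\<^sub>F n in sequentially. rat_pabs p (X n) = d" for d
  proof -
    have "\<forall>\<^sub>F n in sequentially. d = c"
      using that c(2) by eventually_elim simp
    then show ?thesis by simp
  qed
  then have "(THE c. \<forall>\<^sub>F n in sequentially. rat_pabs p (X n) = c) = c"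
    using c(2) by (rule the_equality[rotated])
  then have "pseq_abs p X = c"
    using assms(2) by (simp add: pseq_abs_def)
  with c show "pseq_abs p X > 0" "\<forall>\<^sub>F n in sequentially. rat_pabs p (X n) = pseq_abs p X"
    by simp_all
qed

lemma pseq_abs_nonneg: "pcauchy p X \<Longrightarrow> pseq_abs p X \<ge> 0"
  using pseq_abs_eventually(1)[of X] by (cases "pvanishes p X") (auto simp: pseq_abs_def)

lemma pseq_abs_eqI:
  assumes "pcauchy p X" "c > 0" "\<forall>\<^sub>F n in sequentially. rat_pabs p (X n) = c"
  shows "pseq_abs p X = c"
proof -
  have nv: "\<not> pvanishes p X"
  proof
    assume "pvanishes p X"
    then have "\<forall>\<^sub>F n in sequentially. rat_pabs p (X n) < c"
      using assms(2) by (simp add: pvanishes_def eventually_sequentially)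
    with assms(3) have "\<forall>\<^sub>F n::nat in sequentially. False" by eventually_elim simp
    then show False by simp
  qed
  from assms(3) pseq_abs_eventually(2)[OF assms(1) nv]
  have "\<forall>\<^sub>F n::nat in sequentially. pseq_abs p X = c" by eventually_elim simp
  then show ?thesis by simp
qed

lemma pseq_abs_less_iff:
  assumes "pcauchy p X" "r > 0"
  shows "pseq_abs p X < r \<longleftrightarrow> (\<forall>\<^sub>F n in sequentially. rat_pabs p (X n) < r)"
proof (cases "pvanishes p X")
  case True
  then show ?thesis using assms by (simp add: pseq_abs_def pvanishes_def eventually_sequentially)
next
  case False
  note ev = pseq_abs_eventually(2)[OF assms(1) False]
  from ev have "\<forall>\<^sub>F n in sequentially. (rat_pabs p (X n) < r) = (pseq_abs p X < r)"
    by eventually_elim simp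
  then have "(\<forall>\<^sub>F n in sequentially. rat_pabs p (X n) < r)
      \<longleftrightarrow> (\<forall>\<^sub>F n::nat in sequentially. pseq_abs p X < r)"
    by (rule eventually_subst)
  then show ?thesis by simp
qed

lemma pseq_abs_mono_ev:
  assumes "pcauchy p X" "pcauchy p Y" "pvanishes p (\<lambda>n. X n - Y n)"
  shows "pseq_abs p X \<le> pseq_abs p Y"
proof (rule ccontr)
  assume "\<not> ?thesis"
  then have less: "pseq_abs p Y < pseq_abs p X" by simp
  then have pos: "pseq_abs p X > 0" using pseq_abs_nonneg[OF assms(2)] by linarith
  have "\<forall>\<^sub>F n in sequentially. rat_pabs p (Y n) < pseq_abs p X"
    using less pos pseq_abs_less_iff assms by blast
  moreover have "\<forall>\<^sub>F n in sequentially. rat_pabs p (X n - Y n) < pseq_abs p X"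
    using pos assms(3) by (auto simp: pvanishes_def eventually_sequentially)
  ultimately have "\<forall>\<^sub>F n in sequentially. rat_pabs p (X n) < pseq_abs p X"
  proof eventually_elim
    case (elim n)
    then show ?case using rat_pabs_ultrametric_less[OF p, of "X n - Y n" _ "Y n"] by simp
  qed
  then show False using pos pseq_abs_less_iff assms by blast
qed

end

lift_definition padic_abs :: "'p::prime_card padic \<Rightarrow> rat" is "pseq_abs CARD('p)"
proof -
  fix X Y assume *: "padic_rel TYPE('p) X Y"
  then have "padic_rel TYPE('p) Y X"
    using part_equivp_symp[OF part_equivp_padic_rel] by blast
  with * show "pseq_abs CARD('p) X = pseq_abs CARD('p) Y"
    by (intro antisym pseq_abs_mono_ev) (auto simp: padic_rel_def)
qed

lemma padic_abs_nonneg [simp]: "padic_abs x \<ge> 0"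
  by transfer (simp add: padic_rel_def pseq_abs_nonneg)

lemma padic_abs_eq_0_iff [simp]: "padic_abs x = 0 \<longleftrightarrow> x = 0"
  for x :: "'p::prime_card padic"
proof transfer
  fix X assume "padic_rel TYPE('p) X X"
  then have X: "pcauchy CARD('p) X" by (simp add: padic_rel_def)
  show "pseq_abs CARD('p) X = 0 \<longleftrightarrow> padic_rel TYPE('p) X (\<lambda>_. 0)"
  proof (cases "pvanishes CARD('p) X")
    case True
    then show ?thesis using X by (simp add: padic_rel_def pseq_abs_def)
  next
    case False
    then show ?thesis using X pseq_abs_eventually(1)[OF pcard X]
      by (simp add: padic_rel_def)
  qed
qed

lemma padic_abs_0 [simp]: "padic_abs 0 = 0"
  by simp

lemma padic_abs_minus [simp]: "padic_abs (- x) = padic_abs x"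
  by transfer (simp only: pseq_abs_def pvanishes_def rat_pabs_minus[OF pcard])

lemma padic_abs_minus_commute: "padic_abs (x - y) = padic_abs (y - x)"
  using padic_abs_minus[of "x - y"] by simp

lemma padic_abs_ultrametric: "padic_abs (x + y) \<le> max (padic_abs x) (padic_abs y)"
  for x y :: "'p::prime_card padic"
proof (transfer, rule ccontr)
  fix X Y
  assume "padic_rel TYPE('p) X X" "padic_rel TYPE('p) Y Y"
  then have XY: "pcauchy CARD('p) X" "pcauchy CARD('p) Y" "pcauchy CARD('p) (\<lambda>n. X n + Y n)"
    by (auto simp: padic_rel_def pcauchy_add)
  define r where "r = pseq_abs CARD('p) (\<lambda>n. X n + Y n)"
  assume "\<not> pseq_abs CARD('p) (\<lambda>n. X n + Y n) \<le> max (pseq_abs CARD('p) X) (pseq_abs CARD('p) Y)"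
  then have less: "pseq_abs CARD('p) X < r" "pseq_abs CARD('p) Y < r" by (auto simp: r_def)
  then have r: "r > 0" using pseq_abs_nonneg[OF pcard XY(1)] by linarith
  have "\<forall>\<^sub>F n in sequentially. rat_pabs CARD('p) (X n) < r"
       "\<forall>\<^sub>F n in sequentially. rat_pabs CARD('p) (Y n) < r"
    using less r XY pseq_abs_less_iff[OF pcard] by blast+
  then have "\<forall>\<^sub>F n in sequentially. rat_pabs CARD('p) (X n + Y n) < r"
    by eventually_elim (simp add: rat_pabs_ultrametric_less)
  then show False
    using pseq_abs_less_iff[OF pcard XY(3) r] by (simp add: r_def)
qed

lemma padic_abs_mult: "padic_abs (x * y) = padic_abs x * padic_abs y"
  for x y :: "'p::prime_card padic"
proof (cases "x = 0 \<or> y = 0")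
  case False
  then have "x \<noteq> 0" "y \<noteq> 0" by auto
  then show ?thesis
  proof transfer
    fix X Y
    assume *: "padic_rel TYPE('p) X X" "padic_rel TYPE('p) Y Y"
       "\<not> padic_rel TYPE('p) X (\<lambda>_. 0)" "\<not> padic_rel TYPE('p) Y (\<lambda>_. 0)"
    then have X: "pcauchy CARD('p) X" "\<not> pvanishes CARD('p) X"
      and Y: "pcauchy CARD('p) Y" "\<not> pvanishes CARD('p) Y"
      by (auto simp: padic_rel_def)
    note X' = pseq_abs_eventually[OF pcard X] and Y' = pseq_abs_eventually[OF pcard Y]
    from X'(2) Y'(2) have "\<forall>\<^sub>F n in sequentially.
        rat_pabs CARD('p) (X n * Y n) = pseq_abs CARD('p) X * pseq_abs CARD('p) Y"
      by eventually_elim (simp add: rat_pabs_mult)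
    then show "pseq_abs CARD('p) (\<lambda>n. X n * Y n) = pseq_abs CARD('p) X * pseq_abs CARD('p) Y"
      using X Y X' Y' by (intro pseq_abs_eqI) (auto simp: pcauchy_mult)
  qed
qed auto

lemma padic_of_rat_conv: "padic_of_rat q = of_rat q"
proof -
  have nat: "padic_of_rat (of_nat n) = (of_nat n :: 'a padic)" for n
    by (simp add: padic_of_nat_eq)
  have int: "padic_of_rat (of_int k) = (of_int k :: 'a padic)" for k
  proof (cases k)
    case (nonneg n)
    then show ?thesis by (simp add: nat)
  next
    case (neg n)
    have "padic_of_rat (of_int k) + (of_nat (Suc n) :: 'a padic) = padic_of_rat (of_int k + of_nat (Suc n))"
      unfolding padic_of_rat_add nat ..
    also have "of_int k + of_nat (Suc n) = (0 :: rat)"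
      unfolding neg of_int_minus of_int_of_nat_eq by (rule left_minus)
    finally have "padic_of_rat (of_int k) = - (of_nat (Suc n) :: 'a padic)"
      unfolding padic_of_rat_0 by (rule eq_neg_iff_add_eq_0[THEN iffD2])
    then show ?thesis unfolding neg of_int_minus of_int_of_nat_eq .
  qed
  obtain a b where q: "q = of_int a / of_int b" "b \<noteq> 0" by (rule rat_as_of_int_divide)
  have "padic_of_rat q * (of_int b :: 'a padic) = of_int a"
    unfolding int[symmetric] padic_of_rat_mult[symmetric] using q by simp
  then show ?thesis unfolding q(1) using q(2) by (simp add: of_rat_divide eq_divide_eq)
qed

lemma padic_abs_of_rat: "padic_abs (of_rat q :: 'p::prime_card padic) = rat_pabs CARD('p) q"
proof (cases "q = 0")
  case False
  then show ?thesis
    unfolding padic_of_rat_conv[symmetric]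
    by (transfer fixing: q) (intro pseq_abs_eqI, auto intro: rat_pabs_pos)
qed simp

instantiation padic :: (prime_card) metric_space
begin

definition dist_padic :: "'a padic \<Rightarrow> 'a padic \<Rightarrow> real" where
  "dist_padic x y = real_of_rat (padic_abs (x - y))"

definition uniformity_padic :: "('a padic \<times> 'a padic) filter" where
  "uniformity_padic = (INF e\<in>{0<..}. principal {(x, y). dist x y < e})"

definition open_padic :: "'a padic set \<Rightarrow> bool" where
  "open_padic U \<longleftrightarrow> (\<forall>x\<in>U. \<forall>\<^sub>F (x', y) in uniformity. x' = x \<longrightarrow> y \<in> U)"

instance
proof
  fix x y z :: "'a padic"
  show "dist x y = 0 \<longleftrightarrow> x = y"
    by (simp add: dist_padic_def)
  have "padic_abs ((x - z) + (z - y)) \<le> padic_abs (x - z) + padic_abs (y - z)"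
    using padic_abs_ultrametric[of "x - z" "z - y"] padic_abs_nonneg[of "x - z"]
      padic_abs_nonneg[of "y - z"] unfolding padic_abs_minus_commute[of z y] by linarith
  then show "dist x y \<le> dist x z + dist y z"
    by (simp add: dist_padic_def of_rat_add[symmetric] of_rat_less_eq del: of_rat_add)
qed (simp_all add: uniformity_padic_def open_padic_def)

end

section \<open>Canonical expansions\<close>

text \<open>The integer \<open>log\<^sub>p |x|\<^sub>p\<close>; the floor only fixes the type, since \<open>|x|\<^sub>p\<close> is a power of \<open>p\<close>.\<close>

definition padic_log_abs :: "'p::prime_card padic \<Rightarrow> int" where
  "padic_log_abs x = \<lfloor>log (real CARD('p)) (real_of_rat (padic_abs x))\<rfloor>"

text \<open>\<open>x\<^sup>* = x |x|\<^sub>p\<close>, so that \<open>x = x\<^sup>* / |x|\<^sub>p\<close> for nonzero \<open>x\<close>.\<close>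

definition padic_unit_part :: "'p::prime_card padic \<Rightarrow> 'p padic" where
  "padic_unit_part x = x * of_rat (padic_abs x)"

definition canonical_expansion :: "'p::prime_card padic \<Rightarrow> (nat \<Rightarrow> nat) \<Rightarrow> bool" where
  "canonical_expansion x d \<longleftrightarrow>
     (\<forall>i. d i < CARD('p)) \<and> (\<lambda>i. of_nat (d i) * of_nat CARD('p) ^ i) sums x"

text \<open>Only meaningful for \<open>|x|\<^sub>p \<le> 1\<close>, where the expansion exists and is unique (see below).\<close>

definition first_digit :: "'p::prime_card padic \<Rightarrow> nat" where
  "first_digit x = (THE d. canonical_expansion x d) 0"

lemma padic_abs_eq_powi:
  fixes x :: "'p::prime_card padic"
  assumes "x \<noteq> 0"
  obtains k where "padic_abs x = of_nat CARD('p) powi k"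
proof -
  have "\<exists>k. padic_abs x = of_nat CARD('p) powi k"
    using assms
  proof transfer
    fix X assume "padic_rel TYPE('p) X X" "\<not> padic_rel TYPE('p) X (\<lambda>_. 0)"
    then have X: "pcauchy CARD('p) X" "\<not> pvanishes CARD('p) X"
      by (auto simp: padic_rel_def)
    obtain n where n: "rat_pabs CARD('p) (X n) = pseq_abs CARD('p) X"
      using pseq_abs_eventually(2)[OF pcard X] by (auto simp: eventually_sequentially)
    then have "X n \<noteq> 0" using pseq_abs_eventually(1)[OF pcard X] by auto
    then show "\<exists>k. pseq_abs CARD('p) X = of_nat CARD('p) powi k"
      unfolding n[symmetric] by (auto simp: rat_pabs_def)
  qed
  then show ?thesis using that by blast
qed

lemma padic_log_abs_eq:
  fixes x :: "'p::prime_card padic"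
  assumes "padic_abs x = of_nat CARD('p) powi k"
  shows "padic_log_abs x = k"
proof -
  have "CARD('p) > 1" using prime_gt_1_nat[OF pcard] .
  moreover have "real_of_rat (padic_abs x) = real CARD('p) powi k"
    unfolding assms by (simp add: power_int_def of_rat_power of_rat_inverse)
  moreover have "real CARD('p) powi k = real CARD('p) powr real_of_int k"
    using \<open>CARD('p) > 1\<close> by (simp add: powr_real_of_int')
  ultimately show ?thesis by (simp add: padic_log_abs_def)
qed

lemma padic_dense:
  fixes x :: "'p::prime_card padic"
  assumes "e > 0"
  obtains q where "padic_abs (x - of_rat q) < e"
proof -
  have "\<exists>q. padic_abs (x + - padic_of_rat q) < e"
    using assms
  proof (transfer fixing: e)
    fix X assume e: "e > 0" and "padic_rel TYPE('p) X X"
    then have X: "pcauchy CARD('p) X" by (simp add: padic_rel_def)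
    then obtain k where k: "\<forall>m\<ge>k. \<forall>n\<ge>k. rat_pabs CARD('p) (X m - X n) < e"
      using e unfolding pcauchy_def by blast
    have "pcauchy CARD('p) (\<lambda>n. X n + - X k)"
      by (intro pcauchy_add pcauchy_const X pcard)
    moreover have "\<forall>\<^sub>F n in sequentially. rat_pabs CARD('p) (X n + - X k) < e"
      using k by (auto simp: eventually_sequentially)
    ultimately have "pseq_abs CARD('p) (\<lambda>n. X n + - X k) < e"
      using e pseq_abs_less_iff[OF pcard] by blast
    then show "\<exists>q. pseq_abs CARD('p) (\<lambda>n. X n + - q) < e" by blast
  qed
  then show ?thesis using that by (auto simp: padic_of_rat_conv)
qed

lemma padic_abs_of_int:
  fixes k :: int
  assumes "k \<noteq> 0"
  shows "padic_abs (of_int k :: 'p::prime_card padic)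
       = 1 / of_nat CARD('p) ^ multiplicity (int CARD('p)) k"
proof -
  have "padic_abs (of_rat (of_int k) :: 'p padic) = rat_pabs CARD('p) (of_int k)"
    by (rule padic_abs_of_rat)
  moreover have "rat_pval CARD('p) (of_int k) = int (multiplicity (int CARD('p)) k)"
    using rat_pval_of_int_divide[OF pcard, of k 1] assms by simp
  ultimately show ?thesis using assms
    by (simp add: rat_pabs_def power_int_minus divide_inverse)
qed

lemma padic_abs_of_int_le_1: "padic_abs (of_int k :: 'p::prime_card padic) \<le> 1"
proof (cases "k = 0")
  case False
  have "(1::rat) \<le> of_nat CARD('p) ^ multiplicity (int CARD('p)) k"
    using prime_gt_1_nat[OF pcard[where 'p = 'p]] by (intro one_le_power) simp
  then show ?thesis using False by (simp add: padic_abs_of_int)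
qed simp

lemma padic_abs_of_int_less_1_iff:
  "padic_abs (of_int k :: 'p::prime_card padic) < 1 \<longleftrightarrow> int CARD('p) dvd k"
proof (cases "k = 0")
  case False
  have p: "CARD('p) > 1" using prime_gt_1_nat[OF pcard] .
  have "int CARD('p) dvd k \<longleftrightarrow> multiplicity (int CARD('p)) k > 0"
    using False p prime_multiplicity_gt_zero_iff[of "int CARD('p)" k] by auto
  moreover have "(1::rat) < of_nat CARD('p) ^ multiplicity (int CARD('p)) k
      \<longleftrightarrow> multiplicity (int CARD('p)) k > 0"
    using p by (cases "multiplicity (int CARD('p)) k = 0") auto
  moreover have "(0::rat) < of_nat CARD('p) ^ multiplicity (int CARD('p)) k"
    using p by simp
  ultimately show ?thesis using False by (simp add: padic_abs_of_int divide_less_eq)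
qed simp

lemma padic_digit_exists:
  fixes x :: "'p::prime_card padic"
  assumes "padic_abs x \<le> 1"
  shows "\<exists>d<CARD('p). padic_abs (x - of_nat d) < 1"
proof -
  have p: "CARD('p) > 1" using prime_gt_1_nat[OF pcard] .
  obtain q where q: "padic_abs (x - of_rat q) < 1"
    using padic_dense[of 1 x] by auto
  obtain a b where ab: "quotient_of q = (a, b)" by (cases "quotient_of q") auto
  have b: "b > 0" and cop: "coprime a b" and qab: "q = of_int a / of_int b"
    using quotient_of_denom_pos[OF ab] quotient_of_coprime[OF ab] quotient_of_div[OF ab] by auto
  have qab': "of_rat q * of_int b = (of_int a :: 'p padic)"
    using b by (simp add: qab of_rat_divide)
  have "padic_abs (of_rat q :: 'p padic) \<le> 1"
    using padic_abs_ultrametric[of "of_rat q - x" x] q assms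
    by (simp add: padic_abs_minus_commute[of x])
  have ndvd: "\<not> int CARD('p) dvd b"
  proof
    assume pb: "int CARD('p) dvd b"
    then have "\<not> int CARD('p) dvd a"
      using cop p coprime_common_divisor[of a b "int CARD('p)"] by auto
    then have "padic_abs (of_int a :: 'p padic) = 1"
      using padic_abs_of_int_less_1_iff[of a, where 'p = 'p] padic_abs_of_int_le_1[of a, where 'p = 'p]
      by simp
    moreover have "padic_abs (of_int b :: 'p padic) < 1"
      using pb padic_abs_of_int_less_1_iff by blast
    moreover have "padic_abs (of_rat q :: 'p padic) * padic_abs (of_int b :: 'p padic)
        = padic_abs (of_int a :: 'p padic)"
      unfolding padic_abs_mult[symmetric] qab' ..
    moreover have "padic_abs (of_rat q :: 'p padic) * padic_abs (of_int b :: 'p padic)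
        \<le> 1 * padic_abs (of_int b :: 'p padic)"
      using \<open>padic_abs (of_rat q :: 'p padic) \<le> 1\<close> by (intro mult_right_mono) auto
    ultimately show False by simp
  qed
  then have "coprime b (int CARD('p))"
    using prime_imp_coprime[of "int CARD('p)" b] by (simp add: coprime_commute)
  then obtain c where c: "[b * c = 1] (mod int CARD('p))"
    using cong_solve_coprime_int by blast
  define d where "d = nat ((a * c) mod int CARD('p))"
  have d: "int d = (a * c) mod int CARD('p)" "d < CARD('p)"
    using p by (auto simp: d_def nat_less_iff)
  have "[b * int d = a] (mod int CARD('p))"
  proof -
    have "[b * int d = b * (a * c)] (mod int CARD('p))"
      unfolding d by (intro cong_mult) (auto simp: cong_def)
    also have "b * (a * c) = a * (b * c)" by simp
    also have "[a * (b * c) = a * 1] (mod int CARD('p))"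
      using c by (intro cong_mult) auto
    finally show ?thesis by simp
  qed
  then have "int CARD('p) dvd a - b * int d"
    by (simp add: cong_iff_dvd_diff dvd_diff_commute)
  then have "padic_abs (of_int (a - b * int d) :: 'p padic) < 1"
    using padic_abs_of_int_less_1_iff by blast
  moreover have "padic_abs (of_int b :: 'p padic) = 1"
    using ndvd padic_abs_of_int_less_1_iff[of b, where 'p = 'p] padic_abs_of_int_le_1[of b, where 'p = 'p]
    by simp
  moreover have "(of_rat q - of_nat d) * of_int b = (of_int (a - b * int d) :: 'p padic)"
    using qab' by (simp add: algebra_simps)
  ultimately have "padic_abs (of_rat q - of_nat d :: 'p padic) < 1"
    using padic_abs_mult[of "of_rat q - of_nat d :: 'p padic" "of_int b"] by simp
  then have "padic_abs (x - of_nat d) < 1"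
    using padic_abs_ultrametric[of "x - of_rat q" "of_rat q - of_nat d"] q by simp
  with d show ?thesis by blast
qed

lemma padic_abs_p: "padic_abs (of_nat CARD('p) :: 'p::prime_card padic) = 1 / of_nat CARD('p)"
proof -
  have p: "CARD('p) > 1" using prime_gt_1_nat[OF pcard] .
  then have "multiplicity (int CARD('p)) (int CARD('p)) = 1"
    by (intro multiplicity_self) auto
  then show ?thesis
    using padic_abs_of_int[of "int CARD('p)", where 'p = 'p] p by simp
qed

lemma padic_abs_1 [simp]: "padic_abs (1 :: 'p::prime_card padic) = 1"
  using padic_abs_of_rat[of 1, where 'p = 'p] by simp

lemma padic_abs_power: "padic_abs (x ^ n) = padic_abs x ^ n"
  by (induction n) (simp_all add: padic_abs_mult)

lemma padic_abs_inverse: "padic_abs (inverse x) = inverse (padic_abs x)"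
proof (cases "x = 0")
  case False
  then have "padic_abs x * padic_abs (inverse x) = 1"
    unfolding padic_abs_mult[symmetric] by simp
  then show ?thesis by (metis inverse_unique)
qed simp

lemma padic_abs_unit_part:
  fixes x :: "'p::prime_card padic"
  assumes "x \<noteq> 0"
  shows "padic_abs (padic_unit_part x) = 1"
proof -
  have p: "CARD('p) > 1" using prime_gt_1_nat[OF pcard] .
  obtain k where k: "padic_abs x = of_nat CARD('p) powi k"
    using padic_abs_eq_powi[OF assms] .
  have "padic_abs (of_nat CARD('p) powi k :: 'p padic) = inverse (of_nat CARD('p) powi k)"
    by (simp add: power_int_def padic_abs_power padic_abs_inverse padic_abs_p divide_inverse power_inverse)
  moreover have "(of_rat (padic_abs x) :: 'p padic) = of_nat CARD('p) powi k"
    by (simp add: k power_int_def of_rat_power of_rat_inverse)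
  ultimately show ?thesis
    using p k by (simp add: padic_unit_part_def padic_abs_mult)
qed

lemma padic_abs_divide_p_le_1:
  fixes x :: "'p::prime_card padic"
  assumes "padic_abs x < 1"
  shows "padic_abs (x / of_nat CARD('p)) \<le> 1"
proof (cases "x = 0")
  case False
  have p: "CARD('p) > 1" using prime_gt_1_nat[OF pcard] .
  obtain k where k: "padic_abs x = of_nat CARD('p) powi k"
    using padic_abs_eq_powi[OF False] .
  have "k \<le> - 1"
  proof (rule ccontr)
    assume "\<not> k \<le> - 1"
    then have "padic_abs x = of_nat CARD('p) ^ nat k" by (simp add: k power_int_def)
    moreover have "(1::rat) \<le> of_nat CARD('p) ^ nat k" using p by (intro one_le_power) simp
    ultimately show False using assms by simp
  qed
  then have "padic_abs x \<le> of_nat CARD('p) powi (- 1)"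
    unfolding k using p by (intro power_int_increasing) auto
  then have "padic_abs x * of_nat CARD('p) \<le> inverse (of_nat CARD('p)) * of_nat CARD('p)"
    by (intro mult_right_mono) (simp_all add: power_int_minus)
  also have "inverse (of_nat CARD('p)) * of_nat CARD('p) = (1 :: rat)"
    using p by simp
  also have "padic_abs x * of_nat CARD('p) = padic_abs (x / of_nat CARD('p))"
    unfolding divide_inverse padic_abs_mult padic_abs_inverse padic_abs_p by simp
  finally show ?thesis .
qed simp

lemma canonical_expansion_exists:
  fixes x :: "'p::prime_card padic"
  assumes "padic_abs x \<le> 1"
  shows "\<exists>d. canonical_expansion x d"
proof -
  define p where "p = (of_nat CARD('p) :: 'p padic)"
  have p1: "CARD('p) > 1" using prime_gt_1_nat[OF pcard] .
  then have p0: "p \<noteq> 0" by (simp add: p_def)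
  define dig where "dig y = (SOME d. d < CARD('p) \<and> padic_abs (y - of_nat d :: 'p padic) < 1)" for y
  have dig: "dig y < CARD('p)" "padic_abs (y - of_nat (dig y)) < 1" if "padic_abs y \<le> 1" for y
    using someI_ex[OF padic_digit_exists[OF that]] unfolding dig_def by auto
  define r where "r = rec_nat x (\<lambda>_ y. (y - of_nat (dig y)) / p)"
  have r_Suc: "r (Suc n) = (r n - of_nat (dig (r n))) / p" and r_0: "r 0 = x" for n
    by (simp_all add: r_def)
  have r: "padic_abs (r n) \<le> 1" for n
  proof (induction n)
    case (Suc n)
    then show ?case using padic_abs_divide_p_le_1[OF dig(2)[OF Suc]] by (simp add: r_Suc p_def)
  qed (simp add: r_0 assms)
  have partial: "(\<Sum>i<n. of_nat (dig (r i)) * p ^ i) + p ^ n * r n = x" for n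
  proof (induction n)
    case (Suc n)
    have "p * r (Suc n) = r n - of_nat (dig (r n))" using p0 by (simp add: r_Suc)
    then have "p ^ Suc n * r (Suc n) = p ^ n * (r n - of_nat (dig (r n)))"
      by (simp add: mult.assoc mult.left_commute[of p])
    also have "\<dots> = p ^ n * r n - of_nat (dig (r n)) * p ^ n" by (simp add: algebra_simps)
    finally have "(\<Sum>i<Suc n. of_nat (dig (r i)) * p ^ i) + p ^ Suc n * r (Suc n)
        = (\<Sum>i<n. of_nat (dig (r i)) * p ^ i) + p ^ n * r n"
      by (simp only: sum.lessThan_Suc) simp
    then show ?case using Suc by simp
  qed (simp add: r_0)
  have "(\<lambda>i. of_nat (dig (r i)) * p ^ i) sums x"
    unfolding sums_def LIMSEQ_def
  proof (intro allI impI)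
    fix e :: real assume "e > 0"
    then obtain N where N: "(1 / real CARD('p)) ^ N < e"
      using real_arch_pow_inv[of e "1 / real CARD('p)"] p1 by auto
    have "dist (\<Sum>i<n. of_nat (dig (r i)) * p ^ i) x < e" if "n \<ge> N" for n
    proof -
      have "(\<Sum>i<n. of_nat (dig (r i)) * p ^ i) - x = - (p ^ n * r n)"
        using partial[of n] by (simp add: algebra_simps)
      then have "padic_abs ((\<Sum>i<n. of_nat (dig (r i)) * p ^ i) - x)
          = (1 / of_nat CARD('p)) ^ n * padic_abs (r n)"
        by (simp add: padic_abs_mult padic_abs_power p_def padic_abs_p)
      also have "\<dots> \<le> (1 / of_nat CARD('p)) ^ n * 1"
        using r[of n] by (intro mult_left_mono) auto
      finally have "dist (\<Sum>i<n. of_nat (dig (r i)) * p ^ i) x \<le> real_of_rat ((1 / of_nat CARD('p)) ^ n)"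
        by (simp add: dist_padic_def of_rat_less_eq)
      also have "\<dots> = (1 / real CARD('p)) ^ n"
        by (simp add: of_rat_power of_rat_divide)
      also have "\<dots> \<le> (1 / real CARD('p)) ^ N"
        using that p1 by (intro power_decreasing) auto
      finally show ?thesis using N by linarith
    qed
    then show "\<exists>N. \<forall>n\<ge>N. dist (\<Sum>i<n. of_nat (dig (r i)) * p ^ i) x < e" by blast
  qed
  then show ?thesis
    using dig(1)[OF r] unfolding canonical_expansion_def p_def
    by (intro exI[of _ "\<lambda>i. dig (r i)"]) simp
qed

lemma canonical_expansion_unique:
  fixes x :: "'p::prime_card padic"
  assumes d: "canonical_expansion x d" and e: "canonical_expansion x e"
  shows "d = e"
proof (rule ccontr)
  assume "d \<noteq> e"
  then have ex: "\<exists>k. d k \<noteq> e k" by auto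
  define k where "k = (LEAST k. d k \<noteq> e k)"
  have k: "d k \<noteq> e k" unfolding k_def by (rule LeastI_ex[OF ex])
  have eq: "d i = e i" if "i < k" for i using not_less_Least that unfolding k_def by blast
  define P where "P = int CARD('p)"
  define D where "D n = (\<Sum>i<n. (int (d i) - int (e i)) * P ^ i)" for n
  have P: "P > 1" "prime P" using prime_gt_1_nat[OF pcard[where 'p = 'p]] by (simp_all add: P_def)
  have D: "\<not> P ^ Suc k dvd D n" if "n > k" for n
    using that
  proof (induction n)
    case (Suc n)
    show ?case
    proof (cases "n = k")
      case True
      have "D n = 0" unfolding D_def using True eq by (intro sum.neutral) auto
      then have "D (Suc n) = (int (d k) - int (e k)) * P ^ k" by (simp add: D_def True)
      moreover have "\<not> P dvd int (d k) - int (e k)"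
      proof
        assume "P dvd int (d k) - int (e k)"
        then have "P \<le> \<bar>int (d k) - int (e k)\<bar>" using k by (intro zdvd_imp_le) auto
        moreover have "d k < CARD('p)" "e k < CARD('p)"
          using d e by (auto simp: canonical_expansion_def)
        ultimately show False by (simp add: P_def)
      qed
      ultimately show ?thesis using P(1) by simp
    next
      case False
      then have "k < n" using Suc.prems by simp
      then have "P ^ Suc k dvd (int (d n) - int (e n)) * P ^ n"
        by (intro dvd_mult le_imp_power_dvd) simp
      moreover have "\<not> P ^ Suc k dvd D n" using Suc.IH \<open>k < n\<close> by blast
      ultimately show ?thesis
        unfolding D_def by (simp add: dvd_add_left_iff del: power_Suc)
    qed
  qed simp
  have ge: "padic_abs (of_int (D n) :: 'p padic) \<ge> 1 / of_nat CARD('p) ^ k" if "n > k" for n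
  proof -
    have nz: "D n \<noteq> 0" using D[OF that] by auto
    have "multiplicity P (D n) \<le> k"
    proof (rule ccontr)
      assume "\<not> multiplicity P (D n) \<le> k"
      then have "P ^ Suc k dvd D n" by (intro multiplicity_dvd') simp
      then show False using D[OF that] by blast
    qed
    then show ?thesis
      using P(1) padic_abs_of_int[OF nz, where 'p = 'p]
      by (simp add: P_def frac_le power_increasing)
  qed
  let ?S = "\<lambda>d n. \<Sum>i<n. of_nat (d i) * (of_nat CARD('p) :: 'p padic) ^ i"
  have diff: "?S d n - ?S e n = of_int (D n)" for n
    by (simp add: D_def P_def sum_subtractf[symmetric] algebra_simps)
  define eps where "eps = real_of_rat (1 / of_nat CARD('p) ^ k)"
  have eps: "eps > 0" using P(1) by (simp add: eps_def P_def)
  have "(?S d) \<longlonglongrightarrow> x" "(?S e) \<longlonglongrightarrow> x"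
    using d e by (auto simp: canonical_expansion_def sums_def)
  then obtain M N where MN: "\<And>n. n \<ge> M \<Longrightarrow> dist (?S d n) x < eps"
      "\<And>n. n \<ge> N \<Longrightarrow> dist (?S e n) x < eps"
    using eps unfolding LIMSEQ_def by blast
  define n where "n = Max {M, N, Suc k}"
  have n: "n \<ge> M" "n \<ge> N" "n > k" by (auto simp: n_def)
  have "padic_abs (?S d n - x) < 1 / of_nat CARD('p) ^ k" "padic_abs (x - ?S e n) < 1 / of_nat CARD('p) ^ k"
    using MN(1)[OF n(1)] MN(2)[OF n(2)] unfolding eps_def dist_padic_def of_rat_less
    by (simp_all add: padic_abs_minus_commute[of x])
  then have "padic_abs (?S d n - ?S e n) < 1 / of_nat CARD('p) ^ k"
    using padic_abs_ultrametric[of "?S d n - x" "x - ?S e n"] by simp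
  then show False using ge[OF n(3)] by (simp add: diff)
qed

lemma canonical_expansion_ex1:
  assumes "padic_abs x \<le> 1"
  shows "\<exists>!d. canonical_expansion x d"
  using canonical_expansion_exists[OF assms] canonical_expansion_unique by blast


section \<open>Cardano's formula\<close>

text \<open>
  Roots are not single-valued: the formula is read with some choice of the square root and of
  the two cube roots for which the resulting value is a solution. The same square root
  occurs in both summands.
\<close>

definition cardano_applicable :: "'a::field_char_0 \<Rightarrow> 'a \<Rightarrow> bool" where
  "cardano_applicable a b \<longleftrightarrow>
     (\<exists>s y z x. s ^ 2 = (a / 3) ^ 3 + (b / 2) ^ 2 \<and> y ^ 3 = b / 2 + s \<and> z ^ 3 = b / 2 - s \<and>
        x = y + z \<and> x ^ 3 + a * x = b)"

end

theory Submission
  imports Defs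
begin

text \<open>
  If \<open>s\<^sup>2 = (a/3)\<^sup>3 + (b/2)\<^sup>2\<close> and \<open>y\<^sup>3 = b/2 + s\<close>, then \<open>z = - a/(3y)\<close> is a cube root of \<open>b/2 - s\<close> and
  \<open>y + z\<close> is a solution, so the question is only whether \<open>s\<close> and \<open>y\<close> exist. By Hensel's lemma
  an \<open>n\<close>-th root with \<open>p\<close> not dividing \<open>n\<close> exists iff \<open>n\<close> divides the valuation and the
  leading digit is an \<open>n\<close>-th power residue; in particular a factor in \<open>1 + p\<int>\<^sub>p\<close> does not matter.
  If one of the two terms under the square root dominates, the other is therefore negligible. If both
  have the same size, \<open>s\<close> is \<open>\<sigma>/(18|b|)\<close> with \<open>\<sigma>\<^sup>2 = - 3D\<close>, and everything reduces to
  \<open>108 b\<^sup>* + 12\<sigma>\<close> being a cube; the sign of \<open>\<sigma>\<close> is irrelevant because the product of the two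
  candidates is \<open>(- 12 a\<^sup>*)\<^sup>3\<close>.

  If the method applies, the congruence for \<open>u\<close> fails: by its recurrence \<open>u\<^sub>n\<close> is the coefficient of
  \<open>x\<^sup>2\<close> in \<open>x\<^sup>n\<^sup>+\<^sup>2\<close> modulo \<open>f = x\<^sup>3 + a\<^sub>0 x - b\<^sub>0\<close>. If \<open>f\<close> has a root \<open>\<alpha>\<close> modulo \<open>p\<close>, then Frobenius
  acts on the two remaining roots by the identity or by exchanging them, which gives
  \<open>u\<^sub>p\<^sub>-\<^sub>2 f'(\<alpha>) \<in> {0, 3\<alpha>}\<close>, and both values contradict \<open>D\<^sub>0 u\<^sub>p\<^sub>-\<^sub>2\<^sup>2 = 9 a\<^sub>0\<^sup>2\<close>.
\<close>

section \<open>Power residues\<close>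

text \<open>For a primitive root \<open>g\<close> and \<open>k = g^i\<close>, both sides say that
  \<open>e = gcd n (p - 1)\<close> divides the exponent \<open>i\<close>.\<close>

lemma power_residue_iff:
  fixes k :: int
  assumes p: "prime p" and k: "\<not> int p dvd k" and n: "n > 0"
  shows "(\<exists>t. [t ^ n = k] (mod int p)) \<longleftrightarrow> [k ^ ((p - 1) div gcd n (p - 1)) = 1] (mod int p)"
proof -
  define e where "e = gcd n (p - 1)"
  have p1: "p > 1" using prime_gt_1_nat[OF p] .
  have e0: "e > 0" and en: "e dvd n" and ep: "e dvd p - 1" using n by (simp_all add: e_def)
  obtain g where g: "residue_primroot p g"
    using prime_primitive_root_exists[of p] p p1 by auto
  have gpow: "[int g ^ m = 1] (mod int p) \<longleftrightarrow> p - 1 dvd m" for m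
    using ord_divides[of g m p] g p cong_int_iff[of "g ^ m" 1 p]
    by (simp add: residue_primroot_def totient_prime)
  have gen: "\<exists>i. [x = int g ^ i] (mod int p)" if "\<not> int p dvd x" for x
  proof -
    define y where "y = nat (x mod int p)"
    have y: "int y = x mod int p" using p1 by (simp add: y_def)
    have "y \<in> totatives p"
    proof -
      have "int y < int p" using y p1 by simp
      moreover have "y \<noteq> 0" using y that by (metis dvd_eq_mod_eq_0 of_nat_0)
      ultimately show ?thesis by (simp add: totatives_prime[OF p])
    qed
    then obtain i where "y = g ^ i mod p"
      using residue_primroot_is_generator[OF p1 g] unfolding bij_betw_def by blast
    then have "[int y = int (g ^ i)] (mod int p)" by (simp add: cong_def zmod_int)
    then show ?thesis using y by (auto simp: cong_def)
  qed
  obtain i where i: "[k = int g ^ i] (mod int p)" using gen[OF k] by blast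
  have "[k ^ ((p - 1) div e) = int g ^ (i * ((p - 1) div e))] (mod int p)"
    using cong_pow[OF i] by (simp add: power_mult)
  then have "[k ^ ((p - 1) div e) = 1] (mod int p) \<longleftrightarrow> p - 1 dvd i * ((p - 1) div e)"
    using gpow by (meson cong_sym cong_trans)
  also have "\<dots> \<longleftrightarrow> e dvd i"
  \<comment> \<open>With \<open>p - 1 = e * q\<close> the claim becomes
    \<open>e * q dvd i * q\<close>, and \<open>q\<close> cancels.\<close>
  proof -
    obtain q where q: "p - 1 = e * q" using ep by blast
    then have "q > 0" using p1 by (intro Nat.gr0I) auto
    then show ?thesis using q e0 by simp
  qed
  also have "\<dots> \<longleftrightarrow> (\<exists>t. [t ^ n = k] (mod int p))"
  proof
    assume "e dvd i"
    then obtain j where j: "i = e * j" by blast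
    \<comment> \<open>Bezout gives \<open>n * x = e\<close> modulo \<open>p - 1\<close>, so the
      exponent \<open>x * j\<close> yields an \<open>n\<close>-th root of
      \<open>g^i\<close>.\<close>
    obtain x where "[n * x = e] (mod p - 1)"
      using cong_solve_nat[of n "p - 1"] n by (auto simp: e_def)
    then have "[n * x * j = e * j] (mod p - 1)" by (rule cong_scalar_right)
    then obtain m where m: "[n * m = i] (mod p - 1)"
      unfolding j mult.assoc by blast
    have "[int g ^ (n * m) = int g ^ i] (mod int p)"
      using order_divides_expdiff[of p g "n * m" i] g p m cong_int_iff[of "g ^ (n * m)" "g ^ i" p]
      by (simp add: residue_primroot_def totient_prime)
    then have "[(int g ^ m) ^ n = int g ^ i] (mod int p)"
      by (simp add: power_mult[symmetric] mult.commute)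
    then have "[(int g ^ m) ^ n = k] (mod int p)"
      using i by (meson cong_sym cong_trans)
    then show "\<exists>t. [t ^ n = k] (mod int p)" by blast
  next
    assume "\<exists>t. [t ^ n = k] (mod int p)"
    then obtain t where t: "[t ^ n = k] (mod int p)" by blast
    then have "\<not> int p dvd t" 
      using k n cong_dvd_iff[OF t] by (meson dvd_power dvd_trans)
    then obtain j where "[t = int g ^ j] (mod int p)" using gen by blast
    then have "[t ^ n = int g ^ (j * n)] (mod int p)"
      using cong_pow[of t "int g ^ j" "int p" n] by (simp add: power_mult)
    then have "[int g ^ (j * n) = int g ^ i] (mod int p)"
      using t i by (meson cong_sym cong_trans)
    then have "[j * n = i] (mod p - 1)"
      using order_divides_expdiff[of p g "j * n" i] g p cong_int_iff[of "g ^ (j * n)" "g ^ i" p]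
      by (simp add: residue_primroot_def totient_prime)
    then have "[j * n = i] (mod e)" using ep by (rule cong_dvd_modulus_nat)
    then show "e dvd i" using en by (simp add: cong_dvd_iff[symmetric])
  qed
  finally show ?thesis unfolding e_def by simp
qed

lemma QuadRes_iff_power:
  assumes p: "prime p" "p > 2" and k: "\<not> int p dvd k"
  shows "QuadRes (int p) k \<longleftrightarrow> [k ^ ((p - 1) div 2) = 1] (mod int p)"
proof -
  have "gcd 2 (p - 1) = 2" using prime_odd_nat[OF p(1)] p(2) by (intro gcd_nat.absorb1) auto
  then show ?thesis using power_residue_iff[OF p(1) k, of 2] by (simp add: QuadRes_def)
qed


section \<open>Roots of \<open>p\<close>-adic numbers\<close>

lemma padic_abs_diff_le_max:
  fixes x y :: "'p::prime_card padic"
  shows "padic_abs (x - y) \<le> max (padic_abs x) (padic_abs y)"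
  using padic_abs_ultrametric[of x "- y"] by simp

lemma padic_abs_add_less:
  fixes x y :: "'p::prime_card padic"
  shows "padic_abs x < r \<Longrightarrow> padic_abs y < r \<Longrightarrow> padic_abs (x + y) < r"
  using padic_abs_ultrametric[of x y] by linarith

lemma padic_abs_triangle_less:
  fixes x y z :: "'p::prime_card padic"
  assumes "padic_abs (x - y) < r" "padic_abs (y - z) < r"
  shows "padic_abs (x - z) < r"
  using padic_abs_add_less[OF assms] by simp

lemma padic_abs_eqI:
  fixes x y :: "'p::prime_card padic"
  assumes "padic_abs (x - y) < padic_abs y"
  shows "padic_abs x = padic_abs y"
proof -
  have "padic_abs x \<le> max (padic_abs (x - y)) (padic_abs y)"
    using padic_abs_ultrametric[of "x - y" y] by simp
  moreover have "padic_abs y \<le> max (padic_abs (x - y)) (padic_abs x)"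
    using padic_abs_diff_le_max[of x "x - y"] by (simp add: max.commute)
  ultimately show ?thesis using assms by (simp add: max_def split: if_splits)
qed

lemma padic_abs_divide:
  fixes x y :: "'p::prime_card padic"
  shows "padic_abs (x / y) = padic_abs x / padic_abs y"
  by (simp add: divide_inverse padic_abs_mult padic_abs_inverse)

lemma padic_abs_of_int_eq_1_iff:
  "padic_abs (of_int k :: 'p::prime_card padic) = 1 \<longleftrightarrow> \<not> int CARD('p) dvd k"
  using padic_abs_of_int_less_1_iff[of k, where 'p = 'p] padic_abs_of_int_le_1[of k, where 'p = 'p]
  by auto

section \<open>Completeness\<close>

lemma rat_arch_pow_inv:
  fixes r e :: rat
  assumes "r < 1" "e > 0"
  obtains n where "r ^ n < e"
proof -
  obtain n where "real_of_rat r ^ n < real_of_rat e"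
    using real_arch_pow_inv[of "real_of_rat e" "real_of_rat r"] assms by auto
  then have "r ^ n < e" by (simp only: of_rat_power[symmetric] of_rat_less)
  then show ?thesis using that by blast
qed

text \<open>The limit is the class of the sequence itself: for fixed \<open>n\<close>, the sequence
  with terms \<open>X n - X m\<close> represents the difference between \<open>X n\<close> and that
  class.\<close>

lemma padic_of_rat_seq_converges:
  assumes "pcauchy CARD('p::prime_card) X"
  obtains L :: "'p::prime_card padic" where "\<And>e. e > 0 \<Longrightarrow> \<exists>N. \<forall>n\<ge>N. padic_abs (of_rat (X n) - L) < e"
proof -
  define L :: "'p padic" where "L = padic_class X"
  \<comment> \<open>These rules let \<open>transfer\<close> replace the fixed element
    \<open>L\<close> by its representative \<open>X\<close>.\<close>
  have [transfer_rule]: "cr_padic X L"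
    using assms by (simp add: cr_padic_def L_def padic_rel_refl)
  have [transfer_rule]: "pcr_padic X L"
    using \<open>cr_padic X L\<close> by (simp add: padic.pcr_cr_eq)
  have "\<exists>N. \<forall>n\<ge>N. padic_abs (padic_of_rat (X n) + - L) < e" if e: "e > 0" for e
  proof -
    obtain k where k: "\<forall>m\<ge>k. \<forall>n\<ge>k. rat_pabs CARD('p) (X m - X n) < e"
      using assms e unfolding pcauchy_def by blast
    have "padic_abs (padic_of_rat (X n) + - L) < e" if "n \<ge> k" for n
    proof (transfer fixing: X e n k)
      have "pcauchy CARD('p) (\<lambda>m. X n + - X m)"
        by (intro pcauchy_add pcauchy_const pcauchy_minus assms pcard)
      moreover have "\<forall>\<^sub>F m in sequentially. rat_pabs CARD('p) (X n + - X m) < e"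
        using k that by (auto simp: eventually_sequentially)
      ultimately show "pseq_abs CARD('p) (\<lambda>m. X n + - X m) < e"
        using e pseq_abs_less_iff[OF pcard] by blast
    qed
    then show ?thesis by blast
  qed
  then show ?thesis using that[of L] by (simp add: padic_of_rat_conv)
qed

text \<open>This is the completeness used for Newton iteration. Rationals \<open>q k\<close> within
  \<open>(1/2)^k\<close> of \<open>z k\<close> reduce it to rational Cauchy sequences.\<close>

lemma padic_geometric_converges:
  fixes z :: "nat \<Rightarrow> 'p::prime_card padic"
  assumes r: "r < 1" and z: "\<And>k. padic_abs (z (Suc k) - z k) \<le> r ^ Suc k"
  obtains L where "\<And>k. padic_abs (z k - L) \<le> r ^ Suc k"
proof -
  have r0: "0 \<le> r" using z[of 0] padic_abs_nonneg[of "z (Suc 0) - z 0"] by (simp del: padic_abs_nonneg)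
  \<comment> \<open>In an ultrametric a sum of steps is no larger than its largest step, so no
    geometric series has to be summed.\<close>
  have zz: "padic_abs (z (k + m) - z k) \<le> r ^ Suc k" for k m
  proof (induction m)
    case (Suc m)
    have "r ^ Suc (k + m) \<le> r ^ Suc k" using r r0 by (intro power_decreasing) auto
    then have "padic_abs (z (k + Suc m) - z (k + m)) \<le> r ^ Suc k"
      using z[of "k + m"] by simp
    then show ?case
      using Suc padic_abs_ultrametric[of "z (k + Suc m) - z (k + m)" "z (k + m) - z k"] by simp
  qed (use r0 in simp)
  have "\<exists>q. padic_abs (z k - of_rat q) < (1 / 2) ^ k" for k
    using padic_dense[of "(1 / 2) ^ k" "z k"] by auto
  then obtain q where q: "\<And>k. padic_abs (z k - of_rat (q k)) < (1 / 2) ^ k" by metis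
  have ex: "\<exists>N. r ^ Suc N < e \<and> (1 / 2) ^ N < e" if e: "e > 0" for e :: rat
  proof -
    obtain M where M: "r ^ M < e" using rat_arch_pow_inv[OF r e] .
    obtain N where N: "(1 / 2 :: rat) ^ N < e" using rat_arch_pow_inv[of "1 / 2" e] e by auto
    have "r ^ Suc (M + N) \<le> r ^ M" "(1 / 2 :: rat) ^ (M + N) \<le> (1 / 2) ^ N"
      using r r0 by (intro power_decreasing; simp)+
    then show ?thesis using M N by (blast intro: order.strict_trans1)
  qed
  have near: "padic_abs (of_rat (q m) - of_rat (q n) :: 'p padic) < e"
    if "r ^ Suc N < e" "(1 / 2) ^ N < e" "m \<ge> N" "n \<ge> N" for e N m n
  proof -
    have half: "(1 / 2 :: rat) ^ j \<le> (1 / 2) ^ N" if "j \<ge> N" for j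
      using that by (intro power_decreasing) auto
    have "padic_abs (of_rat (q m) - z m) < e"
      using q[of m] half[OF that(3)] that(2)
      unfolding padic_abs_minus_commute[of "of_rat (q m)"] by linarith
    moreover have "padic_abs (z m - z N) < e" "padic_abs (z n - z N) < e"
      using zz[of N "m - N"] zz[of N "n - N"] that by simp_all
    moreover have "padic_abs (z n - of_rat (q n)) < e"
      using q[of n] half[OF that(4)] that(2) by linarith
    ultimately show ?thesis
      unfolding padic_abs_minus_commute[of "z n" "z N"] by (blast intro: padic_abs_triangle_less)
  qed
  have "pcauchy CARD('p) q"
    unfolding pcauchy_def
  proof (intro allI impI)
    fix e :: rat assume "e > 0"
    then obtain N where N: "r ^ Suc N < e \<and> (1 / 2) ^ N < e" using ex by blast
    have "rat_pabs CARD('p) (q m - q n) < e" if "m \<ge> N" "n \<ge> N" for m n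
      using near[of N e m n] N that by (simp add: padic_abs_of_rat[symmetric] of_rat_diff)
    then show "\<exists>k. \<forall>m\<ge>k. \<forall>n\<ge>k. rat_pabs CARD('p) (q m - q n) < e" by blast
  qed
  then obtain L :: "'p padic" where L: "\<And>e. e > 0 \<Longrightarrow> \<exists>N. \<forall>n\<ge>N. padic_abs (of_rat (q n) - L) < e"
    using padic_of_rat_seq_converges by blast
  have "padic_abs (z k - L) \<le> r ^ Suc k" for k
  proof (rule ccontr)
    \<comment> \<open>If \<open>e\<close> exceeded the bound, then \<open>z k\<close>,
      \<open>z n\<close>, \<open>q n\<close> and \<open>L\<close> would form a chain of three
      distances below \<open>e\<close>, so the ends would be closer than \<open>e\<close>.\<close>
    define e where "e = padic_abs (z k - L)"
    assume "\<not> ?thesis"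
    then have e: "r ^ Suc k < e" by (simp add: e_def)
    moreover have "0 \<le> r ^ Suc k" using r0 by simp
    ultimately have e0: "e > 0" by linarith
    obtain N where N: "\<forall>n\<ge>N. padic_abs (of_rat (q n) - L) < e" using L[OF e0] by blast
    obtain M where M: "r ^ Suc M < e \<and> (1 / 2) ^ M < e" using ex[OF e0] by blast
    define n where "n = k + (N + M)"
    have "(1 / 2 :: rat) ^ n \<le> (1 / 2) ^ M" unfolding n_def by (intro power_decreasing) auto
    then have "padic_abs (z n - of_rat (q n)) < e" using q[of n] M by linarith
    moreover have "padic_abs (of_rat (q n) - L) < e" using N by (simp add: n_def)
    moreover have "padic_abs (z k - z n) < e"
      using zz[of k "N + M"] e by (simp add: n_def padic_abs_minus_commute)
    ultimately have "padic_abs (z k - L) < e" by (meson padic_abs_triangle_less)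
    then show False by (simp add: e_def)
  qed
  then show ?thesis using that by blast
qed

text \<open>Multiplying the expansion for \<open>n\<close> by \<open>z + d\<close> multiplies the
  old remainder by an integral factor and adds only \<open>n * z^(n-1) * d^2\<close>.\<close>

lemma padic_power_taylor:
  fixes z d :: "'p::prime_card padic"
  assumes z: "padic_abs z \<le> 1" and d: "padic_abs d \<le> 1"
  shows "padic_abs ((z + d) ^ n - (z ^ n + of_nat n * z ^ (n - 1) * d)) \<le> padic_abs d ^ 2"
proof (induction n)
  case (Suc n)
  have n: "padic_abs (of_nat n :: 'p padic) \<le> 1"
    using padic_abs_of_int_le_1[of "int n", where 'p = 'p] by simp
  have eq: "(z + d) ^ Suc n - (z ^ Suc n + of_nat (Suc n) * z ^ (Suc n - 1) * d)
      = (z + d) * ((z + d) ^ n - (z ^ n + of_nat n * z ^ (n - 1) * d))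
        + of_nat n * z ^ (n - 1) * d ^ 2"
    by (cases n) (simp_all add: algebra_simps power2_eq_square)
  have zd: "padic_abs (z + d) \<le> 1" using padic_abs_ultrametric[of z d] z d by simp
  have "padic_abs ((z + d) * ((z + d) ^ n - (z ^ n + of_nat n * z ^ (n - 1) * d))) \<le> 1 * padic_abs d ^ 2"
    unfolding padic_abs_mult using zd Suc by (intro mult_mono) auto
  moreover have "padic_abs (of_nat n * z ^ (n - 1) * d ^ 2) \<le> 1 * 1 * padic_abs d ^ 2"
    unfolding padic_abs_mult padic_abs_power using n z
    by (intro mult_mono power_le_one) auto
  ultimately show ?case
    unfolding eq using padic_abs_ultrametric by (smt (verit) max_def mult_1 order_trans)
qed simp

lemma padic_abs_power_diff_le:
  fixes x y :: "'p::prime_card padic"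
  assumes "padic_abs x \<le> 1" "padic_abs y \<le> 1"
  shows "padic_abs (x ^ n - y ^ n) \<le> padic_abs (x - y)"
proof (induction n)
  case (Suc n)
  have eq: "x ^ Suc n - y ^ Suc n = x * (x ^ n - y ^ n) + (x - y) * y ^ n"
    by (simp add: algebra_simps)
  have "padic_abs (x * (x ^ n - y ^ n)) \<le> 1 * padic_abs (x - y)"
    unfolding padic_abs_mult using assms Suc by (intro mult_mono) auto
  moreover have "padic_abs ((x - y) * y ^ n) \<le> padic_abs (x - y) * 1"
    unfolding padic_abs_mult padic_abs_power using assms by (intro mult_mono power_le_one) auto
  ultimately show ?case
    unfolding eq using padic_abs_ultrametric[of "x * (x ^ n - y ^ n)" "(x - y) * y ^ n"] by simp
qed simp

text \<open>Newton iteration for \<open>y^n = x\<close> starting at \<open>t\<close>. Since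
  \<open>n\<close> and all iterates are units, each step is as large as the current error, and the
  next error is at most its square.\<close>

lemma padic_hensel_power:
  fixes x t :: "'p::prime_card padic"
  assumes n: "\<not> CARD('p) dvd n" and t: "padic_abs t = 1" and x: "padic_abs (x - t ^ n) < 1"
  obtains y where "y ^ n = x" "padic_abs (y - t) < 1"
proof -
  define r where "r = padic_abs (x - t ^ n)"
  have r: "0 \<le> r" "r < 1" using x by (simp_all add: r_def)
  have rk: "r ^ Suc k < 1" for k using r by (simp add: power_less_one_iff del: power_Suc)
  have absn: "padic_abs (of_nat n :: 'p padic) = 1"
    using padic_abs_of_int_eq_1_iff[of "int n", where 'p = 'p] n by simp
  then have n0: "(of_nat n :: 'p padic) \<noteq> 0" by (metis padic_abs_0 zero_neq_one)
  define step where "step z = (x - z ^ n) / (of_nat n * z ^ (n - 1))" for z :: "'p padic"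
  define z where "z = rec_nat t (\<lambda>_ z. z + step z)"
  have z_0: "z 0 = t" and z_Suc: "z (Suc k) = z k + step (z k)" for k by (simp_all add: z_def)
  have absstep: "padic_abs (step w) = padic_abs (x - w ^ n)" if "padic_abs w = 1" for w
    using that by (simp add: step_def padic_abs_divide padic_abs_mult padic_abs_power absn)
  have inv: "padic_abs (z k) = 1 \<and> padic_abs (x - z k ^ n) \<le> r ^ Suc k" for k
  proof (induction k)
    case 0
    show ?case by (simp add: z_0 t r_def)
  next
    case (Suc k)
    then have zk: "padic_abs (z k) = 1" and ek: "padic_abs (step (z k)) \<le> r ^ Suc k"
      by (simp_all add: absstep)
    then have zk0: "z k \<noteq> 0" by auto
    have less: "padic_abs (step (z k)) < 1" using ek rk[of k] by linarith
    \<comment> \<open>The linear term cancels the error exactly, so the new error is just the Taylor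
      remainder.\<close>
    have "of_nat n * z k ^ (n - 1) * step (z k) = x - z k ^ n"
      using n0 zk0 by (simp add: step_def)
    then have "padic_abs (x - z (Suc k) ^ n) = padic_abs
        ((z k + step (z k)) ^ n - (z k ^ n + of_nat n * z k ^ (n - 1) * step (z k)))"
      unfolding z_Suc by (simp add: padic_abs_minus_commute)
    also have "\<dots> \<le> padic_abs (step (z k)) ^ 2"
      using zk less by (intro padic_power_taylor) auto
    also have "\<dots> \<le> (r ^ Suc k) ^ 2" using ek by (intro power_mono) auto
    \<comment> \<open>Of the quadratic gain only \<open>2 * (k + 1) \<ge> k + 2\<close> is kept,
      which suffices for geometric convergence.\<close>
    also have "\<dots> \<le> r ^ Suc (Suc k)"
      unfolding power_mult[symmetric] using r by (intro power_decreasing) auto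
    finally show ?case
      using padic_abs_eqI[of "z (Suc k)" "z k"] zk less by (simp add: z_Suc)
  qed
  have "padic_abs (z (Suc k) - z k) \<le> r ^ Suc k" for k
    using inv[of k] absstep[of "z k"] by (simp add: z_Suc)
  then obtain y where y: "\<And>k. padic_abs (z k - y) \<le> r ^ Suc k"
    using padic_geometric_converges[OF r(2), of z] by blast
  have yt: "padic_abs (y - t) < 1"
    using y[of 0] r by (simp add: z_0 padic_abs_minus_commute)
  then have y1: "padic_abs y = 1" using padic_abs_eqI[of y t] t by simp
  have le: "padic_abs (x - y ^ n) \<le> r ^ Suc k" for k
  proof -
    have "padic_abs (z k ^ n - y ^ n) \<le> r ^ Suc k"
      using padic_abs_power_diff_le[of "z k" y n] y[of k] inv[of k] y1 by simp
    then show ?thesis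
      using padic_abs_ultrametric[of "x - z k ^ n" "z k ^ n - y ^ n"] inv[of k]
      by (simp del: power_Suc) (meson max.boundedI order_trans)
  qed
  have "padic_abs (x - y ^ n) = 0"
  proof (rule ccontr)
    assume "\<not> ?thesis"
    then have "padic_abs (x - y ^ n) > 0" using padic_abs_nonneg[of "x - y ^ n"] by linarith
    then obtain k where "r ^ k < padic_abs (x - y ^ n)"
      using rat_arch_pow_inv[OF r(2)] by blast
    moreover have "r ^ Suc k \<le> r ^ k" using r by (intro power_decreasing) auto
    ultimately show False using le[of k] by linarith
  qed
  then have "y ^ n = x" by simp
  then show ?thesis using that yt by blast
qed

text \<open>All later terms of the expansion are divisible by \<open>p\<close>, so the partial sums,
  and hence their limit, stay within distance less than 1 of the first digit.\<close>

lemma padic_abs_diff_first_digit: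
  fixes x :: "'p::prime_card padic"
  assumes x: "padic_abs x \<le> 1"
  shows "padic_abs (x - of_int (int (first_digit x))) < 1"
proof -
  obtain d where d: "canonical_expansion x d" using canonical_expansion_exists[OF x] by blast
  then have "(THE d. canonical_expansion x d) = d"
    using canonical_expansion_unique by blast
  then have fd: "first_digit x = d 0" by (simp add: first_digit_def)
  let ?S = "\<lambda>n. \<Sum>i<n. of_nat (d i) * (of_nat CARD('p) :: 'p padic) ^ i"
  have S: "padic_abs (?S (Suc n) - of_nat (d 0)) < 1" for n
  proof (induction n)
    case (Suc n)
    have "int CARD('p) dvd int (d (Suc n)) * int CARD('p) ^ Suc n" by simp
    then have "padic_abs (of_int (int (d (Suc n)) * int CARD('p) ^ Suc n) :: 'p padic) < 1"
      using padic_abs_of_int_less_1_iff by blast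
    then have "padic_abs (of_nat (d (Suc n)) * (of_nat CARD('p) :: 'p padic) ^ Suc n) < 1"
      by (simp only: of_int_mult of_int_power of_int_of_nat_eq)
    then have "padic_abs ((?S (Suc n) - of_nat (d 0)) + of_nat (d (Suc n)) * of_nat CARD('p) ^ Suc n) < 1"
      using Suc by (rule padic_abs_add_less[rotated])
    then show ?case by (simp only: sum.lessThan_Suc[of _ "Suc n"] add_diff_eq diff_add_eq)
  qed simp
  have "?S \<longlonglongrightarrow> x" using d by (simp add: canonical_expansion_def sums_def)
  then obtain N where "\<And>n. n \<ge> N \<Longrightarrow> dist (?S n) x < 1"
    unfolding LIMSEQ_def using zero_less_one by blast
  from this[of "Suc N"] have "padic_abs (x - ?S (Suc N)) < 1"
    by (simp add: dist_padic_def padic_abs_minus_commute[of x])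
  then show ?thesis unfolding fd using padic_abs_triangle_less[OF _ S[of N]] by simp
qed

text \<open>The condition \<open>padic_abs (x - of_int k) < 1\<close> serves as "\<open>x\<close>
  reduces to \<open>k\<close> modulo \<open>p\<close>"; this lemma says that such a residue is
  unique modulo \<open>p\<close>.\<close>

lemma padic_residue_cong_iff:
  fixes x :: "'p::prime_card padic"
  assumes "padic_abs (x - of_int k) < 1"
  shows "padic_abs (x - of_int l) < 1 \<longleftrightarrow> [k = l] (mod int CARD('p))"
proof -
  have "padic_abs (x - of_int l) < 1 \<longleftrightarrow> padic_abs (of_int k - of_int l :: 'p padic) < 1"
    using assms padic_abs_triangle_less[of x "of_int k" 1 "of_int l"]
      padic_abs_triangle_less[of "of_int k" x 1 "of_int l"]
    by (auto simp: padic_abs_minus_commute[of x])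
  then show ?thesis
    using padic_abs_of_int_less_1_iff[of "k - l", where 'p = 'p] by (simp add: cong_iff_dvd_diff)
qed

lemma padic_residue_unit_iff:
  fixes x :: "'p::prime_card padic"
  assumes "padic_abs (x - of_int k) < 1"
  shows "padic_abs x = 1 \<longleftrightarrow> \<not> int CARD('p) dvd k"
  using padic_abs_eqI[of x "of_int k"] padic_abs_eqI[of "of_int k" x] assms
  unfolding padic_abs_of_int_eq_1_iff[symmetric, where 'p = 'p]
  by (auto simp: padic_abs_minus_commute[of x])

lemma padic_residue_add:
  fixes x y :: "'p::prime_card padic"
  assumes "padic_abs (x - of_int k) < 1" "padic_abs (y - of_int l) < 1"
  shows "padic_abs (x + y - of_int (k + l)) < 1"
  using padic_abs_add_less[OF assms] by (simp add: algebra_simps)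

text \<open>Split \<open>x * y - k * l\<close> as \<open>(x - k) * y + k * (y - l)\<close>, where
  \<open>y\<close> and \<open>k\<close> are integral.\<close>

lemma padic_residue_mult:
  fixes x y :: "'p::prime_card padic"
  assumes x: "padic_abs (x - of_int k) < 1" and y: "padic_abs (y - of_int l) < 1"
  shows "padic_abs (x * y - of_int (k * l)) < 1"
proof -
  have k: "padic_abs (of_int k :: 'p padic) \<le> 1" by (rule padic_abs_of_int_le_1)
  have l: "padic_abs (of_int l :: 'p padic) \<le> 1" by (rule padic_abs_of_int_le_1)
  have "padic_abs y \<le> 1"
    using padic_abs_ultrametric[of "y - of_int l" "of_int l"] y l by simp
  then have "padic_abs ((x - of_int k) * y) < 1"
    unfolding padic_abs_mult using x
    by (metis mult_left_le order.strict_trans1 padic_abs_nonneg)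
  moreover have "padic_abs (of_int k * (y - of_int l)) < 1"
    unfolding padic_abs_mult using y k
    by (metis mult_right_le_one_le order.strict_trans1 padic_abs_nonneg mult.commute)
  ultimately show ?thesis
    using padic_abs_add_less by (fastforce simp: algebra_simps)
qed

lemma padic_residue_power:
  fixes x :: "'p::prime_card padic"
  assumes "padic_abs (x - of_int k) < 1"
  shows "padic_abs (x ^ n - of_int (k ^ n)) < 1"
  using padic_residue_mult[OF assms, of _ "k ^ n" for n] by (induction n) auto

text \<open>A root of a unit is integral and its first digit is a root modulo \<open>p\<close>;
  conversely Hensel's lemma lifts a root modulo \<open>p\<close>.\<close>

lemma padic_unit_root_iff:
  fixes c :: "'p::prime_card padic"
  assumes n: "\<not> CARD('p) dvd n" and c: "padic_abs c = 1" "padic_abs (c - of_int k) < 1"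
  shows "(\<exists>y. y ^ n = c) \<longleftrightarrow> (\<exists>t. [t ^ n = k] (mod int CARD('p)))"
proof
  assume "\<exists>y. y ^ n = c"
  then obtain y where y: "y ^ n = c" by blast
  have n0: "n > 0" using n by (intro Nat.gr0I) auto
  then have "padic_abs y \<le> 1"
    using c(1) y padic_abs_power[of y n] one_less_power[of "padic_abs y" n] by fastforce
  then have "padic_abs (c - of_int (int (first_digit y) ^ n)) < 1"
    using padic_residue_power[OF padic_abs_diff_first_digit, of y n] y by simp
  then have "[int (first_digit y) ^ n = k] (mod int CARD('p))"
    using c(2) padic_residue_cong_iff by blast
  then show "\<exists>t. [t ^ n = k] (mod int CARD('p))" by blast
next
  assume "\<exists>t. [t ^ n = k] (mod int CARD('p))"
  then obtain t where t: "[t ^ n = k] (mod int CARD('p))" by blast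
  then have 1: "padic_abs (c - of_int t ^ n) < 1"
    using padic_residue_cong_iff[OF c(2), of "t ^ n"] by (simp add: cong_sym_eq)
  have n0: "n > 0" using n by (intro Nat.gr0I) auto
  have "\<not> int CARD('p) dvd k" using padic_residue_unit_iff[OF c(2)] c(1) by simp
  then have "\<not> int CARD('p) dvd t"
    using cong_dvd_iff[OF t] n0 by (meson dvd_power dvd_trans)
  then have "padic_abs (of_int t :: 'p padic) = 1" by (simp add: padic_abs_of_int_eq_1_iff)
  then show "\<exists>y. y ^ n = c" using padic_hensel_power[OF n _ 1] by blast
qed

section \<open>Roots of arbitrary nonzero elements\<close>

lemma padic_unit_part_powi:
  fixes x :: "'p::prime_card padic"
  assumes "padic_abs x = of_nat CARD('p) powi k"
  shows "padic_unit_part x = x * of_nat CARD('p) powi k"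
  by (simp add: padic_unit_part_def assms power_int_def of_rat_power of_rat_inverse)

text \<open>A root \<open>y\<close> with \<open>|y| = p^j\<close> forces
  \<open>|c| = p^(j*n)\<close>, and multiplication by \<open>p^j\<close> matches the roots of
  \<open>c\<close> with those of its unit part.\<close>

lemma padic_root_iff:
  fixes c :: "'p::prime_card padic"
  assumes n: "\<not> CARD('p) dvd n" and c: "c \<noteq> 0" "padic_abs (padic_unit_part c - of_int k) < 1"
  shows "(\<exists>y. y ^ n = c) \<longleftrightarrow>
    int n dvd padic_log_abs c \<and> (\<exists>t. [t ^ n = k] (mod int CARD('p)))"
proof -
  have n0: "n > 0" using n by (intro Nat.gr0I) auto
  have p0: "(of_nat CARD('p) :: 'p padic) \<noteq> 0" by simp
  have unit: "(\<exists>y. y ^ n = padic_unit_part c) \<longleftrightarrow> (\<exists>t. [t ^ n = k] (mod int CARD('p)))"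
    using padic_unit_root_iff[OF n padic_abs_unit_part[OF c(1)] c(2)] .
  obtain m where m: "padic_abs c = of_nat CARD('p) powi m" using padic_abs_eq_powi[OF c(1)] .
  have log: "padic_log_abs c = m" using padic_log_abs_eq[OF m] .
  have up: "padic_unit_part c = c * of_nat CARD('p) powi m" using padic_unit_part_powi[OF m] .
  have "(\<exists>y. y ^ n = c) \<longleftrightarrow> int n dvd m \<and> (\<exists>y. y ^ n = padic_unit_part c)"
  proof
    assume "\<exists>y. y ^ n = c"
    then obtain y where y: "y ^ n = c" by blast
    then have "y \<noteq> 0" using c(1) n0 by auto
    then obtain j where j: "padic_abs y = of_nat CARD('p) powi j" using padic_abs_eq_powi by blast
    then have "padic_abs c = of_nat CARD('p) powi (j * int n)"
      unfolding y[symmetric] by (simp add: padic_abs_power power_int_mult)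
    then have mj: "m = j * int n" using padic_log_abs_eq log by metis
    then have "(y * of_nat CARD('p) powi j) ^ n = padic_unit_part c"
      by (simp add: up y power_mult_distrib power_int_mult)
    then show "int n dvd m \<and> (\<exists>y. y ^ n = padic_unit_part c)" using mj by auto
  next
    assume "int n dvd m \<and> (\<exists>y. y ^ n = padic_unit_part c)"
    then obtain j y where jy: "m = j * int n" "y ^ n = padic_unit_part c"
      by (metis dvdE mult.commute)
    have "(y / of_nat CARD('p) powi j) ^ n = c"
      using p0 by (simp add: power_divide jy up power_int_mult)
    then show "\<exists>y. y ^ n = c" by blast
  qed
  then show ?thesis unfolding log unit .
qed

lemma padic_residue_scale:
  fixes x :: "'p::prime_card padic"
  assumes "padic_abs (x - of_int k) < 1"
  shows "padic_abs (of_int c * x - of_int (c * k)) < 1"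
  using padic_residue_mult[OF _ assms, of "of_int c" c] by simp

lemma padic_log_abs_mult_unit:
  fixes c x :: "'p::prime_card padic"
  assumes "padic_abs c = 1"
  shows "padic_log_abs (c * x) = padic_log_abs x" "padic_unit_part (c * x) = c * padic_unit_part x"
  using assms by (simp_all add: padic_log_abs_def padic_unit_part_def padic_abs_mult)


section \<open>The recurrence modulo \<open>p\<close>\<close>

text \<open>Since \<open>(B - s) * (B + s) = - A^3\<close>, the second cube root is
  \<open>- A / y\<close>; the cubic follows from
  \<open>(y - w)^3 + 3*y*w*(y - w) = y^3 - w^3\<close> at \<open>w = A / y\<close>. Working over any
  field serves both the \<open>p\<close>-adic numbers and their residue field.\<close>

lemma cardano_depressed_cubic:
  fixes A B s y :: "'a::field"
  assumes s: "s ^ 2 = A ^ 3 + B ^ 2" and y: "y ^ 3 = B + s" and A: "A \<noteq> 0"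
  shows "(- A / y) ^ 3 = B - s" "(y - A / y) ^ 3 + 3 * A * (y - A / y) = 2 * B"
proof -
  have "(B - s) * (B + s) = B ^ 2 - s ^ 2"
    by (simp add: algebra_simps power2_eq_square)
  then have prod: "(B - s) * y ^ 3 = - (A ^ 3)" unfolding s y by simp
  then have y0: "y \<noteq> 0" using A by (intro notI) simp
  have "(- A / y) ^ 3 = - (A ^ 3) / y ^ 3" by (simp add: power_divide)
  also have "\<dots> = B - s" unfolding prod[symmetric] using y0 by simp
  finally show z: "(- A / y) ^ 3 = B - s" .
  have Ay: "A = y * (A / y)" using y0 by simp
  have "(y - w) ^ 3 + 3 * (y * w) * (y - w) = y ^ 3 - w ^ 3" for w
    by (simp add: algebra_simps power3_eq_cube)
  from this[of "A / y"] have "(y - A / y) ^ 3 + 3 * A * (y - A / y) = y ^ 3 - (A / y) ^ 3"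
    using Ay by simp
  also have "\<dots> = y ^ 3 + (- A / y) ^ 3" by simp
  also have "\<dots> = 2 * B" unfolding y z by simp
  finally show "(y - A / y) ^ 3 + 3 * A * (y - A / y) = 2 * B" .
qed

lemma cardano_applicable_iff:
  fixes a b :: "'a::field_char_0"
  assumes "a \<noteq> 0"
  shows "cardano_applicable a b \<longleftrightarrow>
    (\<exists>s y. s ^ 2 = (a / 3) ^ 3 + (b / 2) ^ 2 \<and> y ^ 3 = b / 2 + s)"
proof
  assume "\<exists>s y. s ^ 2 = (a / 3) ^ 3 + (b / 2) ^ 2 \<and> y ^ 3 = b / 2 + s"
  then obtain s y where s: "s ^ 2 = (a / 3) ^ 3 + (b / 2) ^ 2" and y: "y ^ 3 = b / 2 + s" by blast
  have "(- (a / 3) / y) ^ 3 = b / 2 - s" "(y + - (a / 3) / y) ^ 3 + a * (y + - (a / 3) / y) = b"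
    using cardano_depressed_cubic[OF s y] assms by simp_all
  then show "cardano_applicable a b" using s y unfolding cardano_applicable_def by blast
qed (auto simp: cardano_applicable_def)

text \<open>The substitutions \<open>\<Delta> = 18 * s\<close> and \<open>t = 6 * y\<close> clear
  the denominators in Cardano's formula. Applied modulo \<open>p\<close>, this turns a cube residue
  into a root of the reduced cubic.\<close>

lemma cubic_root_exists_of_cardano:
  fixes a b \<Delta> t :: "'a::field"
  assumes nz: "(2 :: 'a) \<noteq> 0" "(3 :: 'a) \<noteq> 0" "a \<noteq> 0"
    and \<Delta>: "\<Delta> ^ 2 = - 3 * (- 4 * a ^ 3 - 27 * b ^ 2)" and t: "t ^ 3 = 108 * b + 12 * \<Delta>"
  shows "\<exists>\<alpha>. \<alpha> ^ 3 + a * \<alpha> = b"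
proof -
  have six: "(6 :: 'a) \<noteq> 0" using nz mult_eq_0_iff[of 2 "3 :: 'a"] by simp
  define A B s y where "A = a / 3" and "B = b / 2" and "s = \<Delta> / (2 * 3 ^ 2)" and "y = t / (2 * 3)"
  have eqs: "a = 3 * A" "b = 2 * B" "\<Delta> = 2 * 3 ^ 2 * s" "t = 2 * 3 * y"
    using nz six mult_eq_0_iff[of 6 "3 :: 'a"] by (simp_all add: A_def B_def s_def y_def)
  \<comment> \<open>The constants 324 and 216 are kept factored, so that they are nonzero because 2
    and 3 are.\<close>
  have "(2 ^ 2 * 3 ^ 4) * s ^ 2 = (2 ^ 2 * 3 ^ 4) * (A ^ 3 + B ^ 2)"
    using \<Delta> unfolding eqs by (simp add: algebra_simps)
  then have s: "s ^ 2 = A ^ 3 + B ^ 2"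
    using mult_left_cancel[of "2 ^ 2 * 3 ^ 4 :: 'a"] nz(1,2) by (auto simp only: mult_eq_0_iff power_eq_0_iff)
  have "(2 ^ 3 * 3 ^ 3) * y ^ 3 = (2 ^ 3 * 3 ^ 3) * (B + s)"
    using t unfolding eqs by (simp add: algebra_simps)
  then have y: "y ^ 3 = B + s"
    using mult_left_cancel[of "2 ^ 3 * 3 ^ 3 :: 'a"] nz(1,2) by (auto simp only: mult_eq_0_iff power_eq_0_iff)
  have "A \<noteq> 0" using nz(3) eqs(1) by auto
  then show ?thesis using cardano_depressed_cubic(2)[OF s y] unfolding eqs by blast
qed

section \<open>Frobenius and the cubic over the field with \<open>p\<close> elements\<close>

lemma mod_ring_power_card:
  fixes x :: "'p::prime_card mod_ring"
  shows "x ^ CARD('p) = x"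
  using finite_field_power_card_eq_same[of x] by simp

lemma mod_ring_of_int_eq_0_iff:
  "(of_int k :: 'p::prime_card mod_ring) = 0 \<longleftrightarrow> int CARD('p) dvd k"
  using of_int_eq_0_iff_char_dvd[of k, where 'a = "'p mod_ring"] by simp

lemma mod_ring_of_int_eq_iff:
  "(of_int k :: 'p::prime_card mod_ring) = of_int l \<longleftrightarrow> [k = l] (mod int CARD('p))"
  using mod_ring_of_int_eq_0_iff[of "k - l", where 'p = 'p] by (simp add: cong_iff_dvd_diff)

text \<open>Multiplying a remainder by the variable and replacing \<open>x^3\<close> by
  \<open>b - a*x\<close> shifts its coefficients exactly as the recurrence does. Coefficients are
  listed from the constant term upwards.\<close>

lemma cubic_dvd_power_minus_recurrence:
  fixes a b :: "'a::comm_ring_1"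
  assumes u: "u 1 = 0" "u 2 = - a" "u 3 = b"
      "\<And>n. n \<ge> 1 \<Longrightarrow> u (n + 3) = b * u n - a * u (n + 1)"
    and n: "n \<ge> 1"
  shows "[:- b, a, 0, 1:] dvd [:0, 1:] ^ (n + 3) - [:b * u n, u (n + 2), u (n + 1):]"
  using n
proof (induction n rule: dec_induct)
  case base
  have "[:0, 1:] ^ (1 + 3) - [:b * u 1, u (1 + 2), u (1 + 1):] = [:- b, a, 0, 1:] * [:0, 1:]"
    using u by (simp add: numeral_eq_Suc)
  then show ?case by (rule dvdI)
next
  case (step n)
  have "[:0, 1:] ^ (Suc n + 3) - [:b * u (Suc n), u (Suc n + 2), u (Suc n + 1):]
      = [:0, 1:] * ([:0, 1:] ^ (n + 3) - [:b * u n, u (n + 2), u (n + 1):])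
        + [:- b, a, 0, 1:] * [:u (n + 1):]"
    using u(4)[OF step.hyps(1)] by (simp add: algebra_simps numeral_eq_Suc)
  then show ?case using step.IH by (metis dvd_add dvd_mult dvd_triv_left)
qed

text \<open>This describes Frobenius on the roots of a quadratic \<open>g\<close> without a
  splitting field. Modulo \<open>g\<close> the square of \<open>2*x + \<alpha>\<close> is the
  discriminant \<open>\<delta>\<close>, so its \<open>p\<close>-th power is
  \<open>\<delta>^((p-1)/2)\<close> times itself; by Frobenius it is also
  \<open>2*x^p + \<alpha>\<close>.\<close>

lemma linear_power_card_dvd:
  fixes \<alpha> c \<delta> :: "'p::prime_card mod_ring"
  assumes p: "CARD('p) > 2" and \<delta>: "\<delta> = \<alpha> ^ 2 - 4 * c"
  shows "[:c, \<alpha>, 1:] dvd [:2:] * [:0, 1:] ^ CARD('p) + [:\<alpha>:] - [:\<delta> ^ ((CARD('p) - 1) div 2):] * [:\<alpha>, 2:]"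
proof -
  define g where "g = [:c, \<alpha>, 1:]"
  define m where "m = (CARD('p) - 1) div 2"
  have odd: "odd CARD('p)" using prime_odd_nat[OF pcard[where 'p = 'p]] p by blast
  then have m: "CARD('p) = Suc (2 * m)" by (auto simp: m_def elim!: oddE)
  have char: "CARD('p) = CHAR('p mod_ring poly)" by simp
  have sq: "[:\<alpha>, 2:] ^ 2 - [:\<delta>:] = g * [:4:]"
    by (simp add: g_def \<delta> power2_eq_square)
  have "[:\<alpha>, 2:] ^ CARD('p) = ([:\<alpha>:] + ([:2:] * [:0, 1:])) ^ CARD('p)"
    by simp
  also have "\<dots> = [:\<alpha>:] ^ CARD('p) + ([:2:] * [:0, 1:]) ^ CARD('p)"
    by (rule freshmans_dream) (simp_all)
  also have "\<dots> = [:2:] * [:0, 1:] ^ CARD('p) + [:\<alpha>:]"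
    by (simp only: power_mult_distrib poly_const_pow mod_ring_power_card add.commute)
  finally have eq: "[:\<alpha>, 2:] ^ CARD('p) = [:2:] * [:0, 1:] ^ CARD('p) + [:\<alpha>:]" .
  have "g dvd ([:\<alpha>, 2:] ^ 2) ^ m - [:\<delta>:] ^ m"
    unfolding power_diff_sumr2 sq mult.assoc by (rule dvd_triv_left)
  then have "g dvd [:\<alpha>, 2:] * (([:\<alpha>, 2:] ^ 2) ^ m - [:\<delta>:] ^ m)" by (rule dvd_mult)
  also have "[:\<alpha>, 2:] * (([:\<alpha>, 2:] ^ 2) ^ m - [:\<delta>:] ^ m)
      = [:\<alpha>, 2:] ^ CARD('p) - [:\<delta> ^ m:] * [:\<alpha>, 2:]"
    by (simp only: m power_Suc power_mult poly_const_pow right_diff_distrib) simp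
  finally show ?thesis unfolding eq g_def m_def .
qed

text \<open>The cubic is \<open>(x - \<alpha>) * g\<close> with
  \<open>g = x^2 + \<alpha>*x + c\<close>. Comparing the remainder of \<open>x^p\<close> with its
  value at \<open>\<alpha>\<close> and with its residue modulo \<open>g\<close> gives three linear
  equations for \<open>A\<close>, \<open>B\<close>, \<open>C\<close>, which determine
  \<open>C\<close> times the derivative at \<open>\<alpha>\<close>.\<close>

lemma cubic_root_imp_recurrence_neq:
  fixes a b \<alpha> :: "'p::prime_card mod_ring"
  assumes p: "CARD('p) > 3"
    and u: "u 1 = 0" "u 2 = - a" "u 3 = b"
      "\<And>n. n \<ge> 1 \<Longrightarrow> u (n + 3) = b * u n - a * u (n + 1)"
    and nz: "a \<noteq> 0" "b \<noteq> 0" "- 4 * a ^ 3 - 27 * b ^ 2 \<noteq> 0"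
    and \<alpha>: "\<alpha> ^ 3 + a * \<alpha> = b"
  shows "(- 4 * a ^ 3 - 27 * b ^ 2) * u (CARD('p) - 2) ^ 2 \<noteq> 9 * a ^ 2"
proof
  define c where "c = \<alpha> ^ 2 + a"
  define \<delta> where "\<delta> = \<alpha> ^ 2 - 4 * c"
  define \<epsilon> where "\<epsilon> = \<delta> ^ ((CARD('p) - 1) div 2)"
  \<comment> \<open>These are the coefficients of the remainder of \<open>x^p\<close>; the index
    shift comes from writing \<open>p\<close> as \<open>(p - 3) + 3\<close>.\<close>
  define A B C where "A = b * u (CARD('p) - 3)" and "B = u (CARD('p) - 1)" and "C = u (CARD('p) - 2)"
  have nat: "(of_nat k :: 'p mod_ring) \<noteq> 0" if "0 < k" "k < CARD('p)" for k
    using that of_nat_eq_0_iff_char_dvd[of k, where 'a = "'p mod_ring"] by (auto dest: dvd_imp_le)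
  have two: "(2 :: 'p mod_ring) \<noteq> 0" and three: "(3 :: 'p mod_ring) \<noteq> 0"
    using nat[of 2] nat[of 3] p by simp_all
  have p3: "CARD('p) - 3 \<ge> 1" "CARD('p) - 3 + 3 = CARD('p)"
    "CARD('p) - 3 + 2 = CARD('p) - 1" "CARD('p) - 3 + 1 = CARD('p) - 2" using p by auto
  have f: "[:- b, a, 0, 1:] dvd [:0, 1:] ^ CARD('p) - [:A, B, C:]"
    using cubic_dvd_power_minus_recurrence[of u, OF u p3(1)] unfolding p3 A_def B_def C_def .
  have fg: "[:- b, a, 0, 1:] = [:- \<alpha>, 1:] * [:c, \<alpha>, 1:]"
    using \<alpha> by (simp add: c_def algebra_simps power2_eq_square power3_eq_cube)
  have "[:- \<alpha>, 1:] dvd [:0, 1:] ^ CARD('p) - [:A, B, C:]"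
    using f unfolding fg by (rule dvd_mult_left)
  then have "\<alpha> ^ CARD('p) = A + B * \<alpha> + C * \<alpha> ^ 2"
    by (simp add: poly_eq_0_iff_dvd[symmetric] algebra_simps power2_eq_square)
  then have eq1: "\<alpha> = A + B * \<alpha> + C * \<alpha> ^ 2" by (simp add: mod_ring_power_card)
  have g1: "[:c, \<alpha>, 1:] dvd [:0, 1:] ^ CARD('p) - [:A, B, C:]"
    using f unfolding fg by (rule dvd_mult_right)
  have g2: "[:c, \<alpha>, 1:] dvd [:2:] * [:0, 1:] ^ CARD('p) + [:\<alpha>:] - [:\<epsilon>:] * [:\<alpha>, 2:]"
    unfolding \<epsilon>_def using p by (intro linear_power_card_dvd) (simp_all add: \<delta>_def)
  \<comment> \<open>The combination cancels \<open>x^p\<close> and then the \<open>x^2\<close> term.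
    What is left is at most linear but divisible by a quadratic, hence zero.\<close>
  have "[:c, \<alpha>, 1:] dvd ([:2:] * [:0, 1:] ^ CARD('p) + [:\<alpha>:] - [:\<epsilon>:] * [:\<alpha>, 2:])
      - [:2:] * ([:0, 1:] ^ CARD('p) - [:A, B, C:]) - [:c, \<alpha>, 1:] * [:2 * C:]"
    by (intro dvd_diff[OF dvd_diff[OF g2 dvd_mult[OF g1]] dvd_triv_left])
  also have "\<dots> = [:\<alpha>:] - [:\<epsilon>:] * [:\<alpha>, 2:] + [:2:] * [:A, B, C:] - [:c, \<alpha>, 1:] * [:2 * C:]"
    by (simp only: right_diff_distrib) simp
  also have "\<dots> = [:2 * A + \<alpha> - \<epsilon> * \<alpha> - 2 * C * c, 2 * B - 2 * \<epsilon> - 2 * C * \<alpha>:]"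
    by (simp add: algebra_simps)
  finally have dvd: "[:c, \<alpha>, 1:] dvd [:2 * A + \<alpha> - \<epsilon> * \<alpha> - 2 * C * c, 2 * B - 2 * \<epsilon> - 2 * C * \<alpha>:]" .
  have "[:2 * A + \<alpha> - \<epsilon> * \<alpha> - 2 * C * c, 2 * B - 2 * \<epsilon> - 2 * C * \<alpha>:] = 0"
  proof (rule ccontr)
    assume "\<not> ?thesis"
    from dvd_imp_degree_le[OF dvd this] show False by (auto split: if_splits)
  qed
  then have eq2: "2 * A + \<alpha> - \<epsilon> * \<alpha> - 2 * C * c = 0" and eq3: "2 * B - 2 * \<epsilon> - 2 * C * \<alpha> = 0"
    by simp_all
  \<comment> \<open>Eliminating \<open>A\<close> and \<open>B\<close> leaves \<open>C\<close> times
    \<open>3*\<alpha>^2 + a\<close>, the derivative of the cubic at \<open>\<alpha>\<close>, which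
    is also the value of \<open>g\<close> there.\<close>
  have key: "3 * \<alpha> * (1 - \<epsilon>) = 2 * (C * (3 * \<alpha> ^ 2 + a))"
  proof -
    have "3 * \<alpha> * (1 - \<epsilon>) - 2 * (C * (3 * \<alpha> ^ 2 + a))
        = 2 * (\<alpha> - (A + B * \<alpha> + C * \<alpha> ^ 2))
          + (2 * A + \<alpha> - \<epsilon> * \<alpha> - 2 * C * c) + \<alpha> * (2 * B - 2 * \<epsilon> - 2 * C * \<alpha>)"
      by (simp add: c_def algebra_simps power2_eq_square)
    also have "\<alpha> - (A + B * \<alpha> + C * \<alpha> ^ 2) = 0"
      using eq1 by (rule eq_iff_diff_eq_0[THEN iffD1])
    finally show ?thesis unfolding eq2 eq3 by simp
  qed
  \<comment> \<open>The discriminant of \<open>(x - \<alpha>) * g\<close> is that of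
    \<open>g\<close> times the square of \<open>g\<close> at \<open>\<alpha>\<close>.\<close>
  have disc: "- 4 * a ^ 3 - 27 * b ^ 2 = \<delta> * (3 * \<alpha> ^ 2 + a) ^ 2"
    by (simp add: \<delta>_def c_def \<alpha>[symmetric] algebra_simps power2_eq_square power3_eq_cube)
  then have \<delta>0: "\<delta> \<noteq> 0" and d0: "3 * \<alpha> ^ 2 + a \<noteq> 0" using nz(3) by auto
  have c0: "\<alpha> ^ 2 + a \<noteq> 0"
  proof
    assume "\<alpha> ^ 2 + a = 0"
    then have "\<alpha> * (\<alpha> ^ 2 + a) = 0" by simp
    then have "b = 0" using \<alpha> by (simp add: algebra_simps power2_eq_square power3_eq_cube)
    then show False using nz(2) by simp
  qed
  have "odd CARD('p)" using prime_odd_nat[OF pcard[where 'p = 'p]] p by linarith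
  then have "2 * ((CARD('p) - 1) div 2) = CARD('p) - 1" by auto
  then have "\<epsilon> ^ 2 = \<delta> ^ (CARD('p) - 1)"
    by (simp add: \<epsilon>_def power_mult[symmetric] mult.commute)
  moreover have "\<delta> * \<delta> ^ (CARD('p) - 1) = \<delta>"
    using mod_ring_power_card[of \<delta>] p by (simp add: power_Suc[symmetric] del: power_Suc)
  ultimately have "\<epsilon> ^ 2 = 1" using \<delta>0 by simp
  then have \<epsilon>: "\<epsilon> = 1 \<or> \<epsilon> = - 1" by (simp add: power2_eq_1_iff)
  assume "(- 4 * a ^ 3 - 27 * b ^ 2) * u (CARD('p) - 2) ^ 2 = 9 * a ^ 2"
  then have eq: "\<delta> * (C * (3 * \<alpha> ^ 2 + a)) ^ 2 = 9 * a ^ 2"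
    unfolding disc C_def by (simp add: power_mult_distrib mult_ac)
  have nine: "(9 :: 'p mod_ring) \<noteq> 0"
    using three mult_eq_0_iff[of 3 "3 :: 'p mod_ring"] by simp
  from \<epsilon> show False
  proof
    assume "\<epsilon> = 1"
    then have "2 * (C * (3 * \<alpha> ^ 2 + a)) = 0" unfolding key[symmetric] by simp
    then have C: "C * (3 * \<alpha> ^ 2 + a) = 0" using two by (metis mult_eq_0_iff)
    have "9 * a ^ 2 = 0" using eq unfolding C by simp
    then show False using nine nz(1) by simp
  next
    assume "\<epsilon> = - 1"
    then have "2 * (C * (3 * \<alpha> ^ 2 + a)) = 2 * (3 * \<alpha>)" unfolding key[symmetric] by simp
    then have C: "C * (3 * \<alpha> ^ 2 + a) = 3 * \<alpha>" using two by (metis mult_left_cancel)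
    have "\<delta> * (3 * \<alpha>) ^ 2 - 9 * a ^ 2 = 0" using eq unfolding C by simp
    \<comment> \<open>Both factors on the right are nonzero: the first divides the discriminant, the
      second divides \<open>b\<close>.\<close>
    also have "\<delta> * (3 * \<alpha>) ^ 2 - 9 * a ^ 2 = - (9 * ((3 * \<alpha> ^ 2 + a) * (\<alpha> ^ 2 + a)))"
      by (simp add: \<delta>_def c_def algebra_simps power2_eq_square)
    finally show False using nine c0 d0 by simp
  qed
qed

text \<open>Read in the residue field, \<open>\<Delta>\<close> and \<open>t\<close> supply the data
  of Cardano's formula, hence the root that the preceding lemma requires.\<close>

lemma recurrence_not_cong:
  fixes a b \<Delta> t :: int and u :: "nat \<Rightarrow> int"
  assumes p: "CARD('p::prime_card) > 3"
    and u: "u 1 = 0" "u 2 = - a" "u 3 = b"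
      "\<And>n. n \<ge> 1 \<Longrightarrow> u (n + 3) = b * u n - a * u (n + 1)"
    and nd: "\<not> int CARD('p) dvd a" "\<not> int CARD('p) dvd b"
      "\<not> int CARD('p) dvd - 4 * a ^ 3 - 27 * b ^ 2"
    and \<Delta>: "[\<Delta> ^ 2 = - 3 * (- 4 * a ^ 3 - 27 * b ^ 2)] (mod int CARD('p))"
    and t: "[t ^ 3 = 108 * b + 12 * \<Delta>] (mod int CARD('p))"
  shows "\<not> [(- 4 * a ^ 3 - 27 * b ^ 2) * u (CARD('p) - 2) ^ 2 = 9 * a ^ 2] (mod int CARD('p))"
proof -
  note eq = mod_ring_of_int_eq_iff[where 'p = 'p] and zero = mod_ring_of_int_eq_0_iff[where 'p = 'p]
  define A B \<Delta>' t' where "A = (of_int a :: 'p mod_ring)" and "B = (of_int b :: 'p mod_ring)"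
    and "\<Delta>' = (of_int \<Delta> :: 'p mod_ring)" and "t' = (of_int t :: 'p mod_ring)"
  have 23: "(2 :: 'p mod_ring) \<noteq> 0" "(3 :: 'p mod_ring) \<noteq> 0"
    using zero[of 2] zero[of 3] zdvd_imp_le[of "int CARD('p)" 2] zdvd_imp_le[of "int CARD('p)" 3] p
    by auto
  have nz: "A \<noteq> 0" "B \<noteq> 0" "- 4 * A ^ 3 - 27 * B ^ 2 \<noteq> 0"
    using nd[folded zero] by (simp_all add: A_def B_def)
  have "\<Delta>' ^ 2 = - 3 * (- 4 * A ^ 3 - 27 * B ^ 2)"
    using \<Delta>[folded eq] by (simp add: A_def B_def \<Delta>'_def)
  moreover have "t' ^ 3 = 108 * B + 12 * \<Delta>'"
    using t[folded eq] by (simp add: B_def \<Delta>'_def t'_def)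
  ultimately obtain \<alpha> where "\<alpha> ^ 3 + A * \<alpha> = B"
    using cubic_root_exists_of_cardano[OF 23 nz(1)] by blast
  moreover have "of_int (u (n + 3)) = B * of_int (u n) - A * of_int (u (n + 1))" if "n \<ge> 1" for n
    using u(4)[OF that] by (simp add: A_def B_def)
  ultimately have "(- 4 * A ^ 3 - 27 * B ^ 2) * of_int (u (CARD('p) - 2)) ^ 2 \<noteq> 9 * A ^ 2"
    using p u(1-3) nz
    by (intro cubic_root_imp_recurrence_neq[where u = "\<lambda>n. of_int (u n)"]) (auto simp: A_def B_def)
  then show ?thesis unfolding eq[symmetric] by (simp add: A_def B_def)
qed


section \<open>Cardano's formula over the \<open>p\<close>-adic numbers\<close>

lemma padic_abs_pos: "x \<noteq> 0 \<Longrightarrow> 0 < padic_abs x"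
  for x :: "'p::prime_card padic"
  using padic_abs_nonneg[of x] padic_abs_eq_0_iff[of x] by linarith

lemma not_card_dvd_2_3:
  assumes "CARD('p::prime_card) > 3"
  shows "\<not> CARD('p) dvd 2" "\<not> CARD('p) dvd 3"
  using assms dvd_imp_le[of "CARD('p)" 2] dvd_imp_le[of "CARD('p)" 3] by linarith+

lemma padic_abs_2_3:
  assumes "CARD('p::prime_card) > 3"
  shows "padic_abs (2 :: 'p padic) = 1" "padic_abs (3 :: 'p padic) = 1"
proof -
  have "\<not> int CARD('p) dvd 2" "\<not> int CARD('p) dvd 3"
    using assms zdvd_imp_le[of "int CARD('p)" 2] zdvd_imp_le[of "int CARD('p)" 3] by linarith+
  then show "padic_abs (2 :: 'p padic) = 1" "padic_abs (3 :: 'p padic) = 1"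
    unfolding padic_abs_of_int_eq_1_iff[symmetric] by simp_all
qed

lemma padic_root_near_1:
  fixes x :: "'p::prime_card padic"
  assumes "\<not> CARD('p) dvd n" "padic_abs (x - 1) < 1"
  obtains y where "y ^ n = x" "padic_abs (y - 1) < 1"
  using padic_hensel_power[of n 1 x] assms by auto

lemma padic_root_mult_near_1_iff:
  fixes c x :: "'p::prime_card padic"
  assumes "\<not> CARD('p) dvd n" "padic_abs (x - 1) < 1"
  shows "(\<exists>y. y ^ n = c * x) \<longleftrightarrow> (\<exists>y. y ^ n = c)"
proof -
  obtain w where w: "w ^ n = x" "padic_abs (w - 1) < 1" using padic_root_near_1[OF assms] .
  then have w0: "w \<noteq> 0" by auto
  have "(y / w) ^ n = c" if "y ^ n = c * x" for y
    using that w0 by (simp add: power_divide w(1)[symmetric])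
  moreover have "(y * w) ^ n = c * x" if "y ^ n = c" for y
    using that by (simp add: power_mult_distrib w(1))
  ultimately show ?thesis by blast
qed

text \<open>The radicand is \<open>(b/2)^2 * (1 + \<epsilon>)\<close> with
  \<open>|\<epsilon>| < 1\<close>, so \<open>s\<close> is close to \<open>b/2\<close> or to
  \<open>- b/2\<close>. One of \<open>b/2 + s\<close> and \<open>b/2 - s\<close> is then
  \<open>b\<close> times an element near 1, and applicability makes both of them cubes.\<close>

lemma cardano_applicable_iff_cube:
  fixes a b :: "'p::prime_card padic"
  assumes p: "CARD('p) > 3" and nz: "a \<noteq> 0" "b \<noteq> 0" and less: "padic_abs a ^ 3 < padic_abs b ^ 2"
  shows "cardano_applicable a b \<longleftrightarrow> (\<exists>r. r ^ 3 = b)"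
proof -
  note abs23 = padic_abs_2_3[OF p] and dvd23 = not_card_dvd_2_3[OF p]
  define \<epsilon> where "\<epsilon> = (a / 3) ^ 3 / (b / 2) ^ 2"
  have \<epsilon>: "padic_abs \<epsilon> < 1"
    using less nz by (simp add: \<epsilon>_def padic_abs_divide padic_abs_power abs23)
  have cube: "(\<exists>y. y ^ 3 = b / 2 + s) \<longleftrightarrow> (\<exists>r. r ^ 3 = b)" if "padic_abs (2 * s / b - 1) < 1" for s
  proof -
    define x where "x = 1 + (2 * s / b - 1) / 2"
    have "b / 2 + s = b * x" using nz by (simp add: x_def field_simps)
    moreover have "padic_abs (x - 1) < 1"
      using that unfolding x_def by (simp add: padic_abs_divide abs23)
    ultimately show ?thesis using padic_root_mult_near_1_iff[OF dvd23(2)] by metis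
  qed
  show ?thesis
  proof
    assume "cardano_applicable a b"
    then obtain s y z where s: "s ^ 2 = (a / 3) ^ 3 + (b / 2) ^ 2" and y: "y ^ 3 = b / 2 + s"
      and z: "z ^ 3 = b / 2 - s" unfolding cardano_applicable_def by blast
    have "(2 * s / b) ^ 2 = 4 * s ^ 2 / b ^ 2" by (simp add: power_divide power_mult_distrib)
    also have "\<dots> = 1 + \<epsilon>"
      using nz unfolding s \<epsilon>_def by (simp add: field_simps)
    finally have "(2 * s / b - 1) * (2 * s / b + 1) = \<epsilon>"
      by (simp add: algebra_simps power2_eq_square)
    then have prod: "padic_abs (2 * s / b - 1) * padic_abs (2 * s / b + 1) < 1"
      using \<epsilon> by (simp add: padic_abs_mult[symmetric])
    \<comment> \<open>The product of the two factors is \<open>\<epsilon>\<close>, so they cannot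
      both have absolute value at least 1.\<close>
    have "padic_abs (2 * s / b - 1) < 1 \<or> padic_abs (2 * s / b + 1) < 1"
    proof (rule ccontr)
      assume "\<not> ?thesis"
      then have "1 * 1 \<le> padic_abs (2 * s / b - 1) * padic_abs (2 * s / b + 1)"
        by (intro mult_mono) auto
      then show False using prod by simp
    qed
    then show "\<exists>r. r ^ 3 = b"
    proof
      assume "padic_abs (2 * s / b - 1) < 1"
      then show ?thesis using cube y by blast
    next
      assume "padic_abs (2 * s / b + 1) < 1"
      then have "padic_abs (- (2 * s / b + 1)) < 1" by (simp only: padic_abs_minus)
      moreover have "- (2 * s / b + 1) = 2 * (- s) / b - 1" by simp
      moreover have "z ^ 3 = b / 2 + (- s)" using z by simp
      ultimately show ?thesis using cube[of "- s"] by metis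
    qed
  next
    assume r: "\<exists>r. r ^ 3 = b"
    obtain w where w: "w ^ 2 = 1 + \<epsilon>" "padic_abs (w - 1) < 1"
      using padic_root_near_1[OF dvd23(1), of "1 + \<epsilon>"] \<epsilon> by auto
    define s where "s = b / 2 * w"
    have "s ^ 2 = (b / 2) ^ 2 * (1 + \<epsilon>)" by (simp only: s_def power_mult_distrib w)
    then have s: "s ^ 2 = (a / 3) ^ 3 + (b / 2) ^ 2"
      using nz by (simp add: \<epsilon>_def distrib_left)
    have "2 * s / b = w" using nz by (simp add: s_def)
    then have "\<exists>y. y ^ 3 = b / 2 + s" using cube[of s] w(2) r by simp
    then show "cardano_applicable a b" using s cardano_applicable_iff[OF nz(1)] by blast
  qed
qed

text \<open>Up to a square factor near 1 the radicand is \<open>(a/3)^3 = 3*a * (a/9)^2\<close>, so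
  only \<open>3*a\<close> must be a square. The cube root then exists automatically, because
  \<open>s\<close> dominates \<open>b/2\<close> and is a cube times an element near 1.\<close>

lemma cardano_applicable_iff_square:
  fixes a b :: "'p::prime_card padic"
  assumes p: "CARD('p) > 3" and nz: "a \<noteq> 0" and less: "padic_abs b ^ 2 < padic_abs a ^ 3"
  shows "cardano_applicable a b \<longleftrightarrow> (\<exists>r. r ^ 2 = 3 * a)"
proof -
  note abs23 = padic_abs_2_3[OF p] and dvd23 = not_card_dvd_2_3[OF p]
  define \<epsilon> where "\<epsilon> = (b / 2) ^ 2 / (a / 3) ^ 3"
  have \<epsilon>: "padic_abs \<epsilon> < 1"
    using less padic_abs_pos[OF nz] by (simp add: \<epsilon>_def padic_abs_divide padic_abs_power abs23)
  obtain w where w: "w ^ 2 = 1 + \<epsilon>" "padic_abs (w - 1) < 1"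
    using padic_root_near_1[OF dvd23(1), of "1 + \<epsilon>"] \<epsilon> by auto
  have w0: "w \<noteq> 0" using w(2) by auto
  have rhs: "(a / 3) ^ 3 + (b / 2) ^ 2 = (a / 3) ^ 3 * w ^ 2"
    using nz by (simp add: w(1) \<epsilon>_def distrib_left)
  show ?thesis
  proof
    assume "cardano_applicable a b"
    then obtain s where s: "s ^ 2 = (a / 3) ^ 3 * w ^ 2"
      unfolding cardano_applicable_def rhs by blast
    have "(3 * (s / w) / (a / 3)) ^ 2 = 9 * (s ^ 2 / w ^ 2) / (a / 3) ^ 2"
      by (simp add: power_divide power_mult_distrib)
    also have "s ^ 2 / w ^ 2 = (a / 3) ^ 3" using w0 by (simp add: s)
    also have "9 * (a / 3) ^ 3 / (a / 3) ^ 2 = 3 * a"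
      using nz by (simp add: field_simps power2_eq_square power3_eq_cube)
    finally show "\<exists>r. r ^ 2 = 3 * a" by blast
  next
    assume "\<exists>r. r ^ 2 = 3 * a"
    then obtain r where r: "r ^ 2 = 3 * a" by blast
    define q where "q = r / 3"
    have q: "q ^ 2 = a / 3" by (simp add: q_def power_divide r)
    have q6: "(q ^ 3) ^ 2 = (a / 3) ^ 3" unfolding q[symmetric] by simp
    have q0: "q \<noteq> 0" using q nz by auto
    define s where "s = q ^ 3 * w"
    have s: "s ^ 2 = (a / 3) ^ 3 + (b / 2) ^ 2" unfolding rhs s_def power_mult_distrib q6 ..
    \<comment> \<open>Since \<open>q^6 = (a/3)^3\<close>, the square of \<open>e\<close> is
      \<open>\<epsilon>\<close>; thus \<open>e\<close> is small and
      \<open>b/2 + s = q^3 * (w + e)\<close>.\<close>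
    define e where "e = (b / 2) / q ^ 3"
    have "e ^ 2 = \<epsilon>" unfolding e_def \<epsilon>_def q6[symmetric] by (simp add: power_divide)
    then have "padic_abs e ^ 2 < 1" using \<epsilon> by (simp add: padic_abs_power[symmetric])
    then have "padic_abs e < 1" by (simp add: power_less_one_iff)
    then have "padic_abs (w + e - 1) < 1" using padic_abs_add_less[OF w(2), of e] by (simp add: algebra_simps)
    then obtain v where v: "v ^ 3 = w + e" using padic_root_near_1[OF dvd23(2)] by blast
    have "(q * v) ^ 3 = b / 2 + s"
      using q0 by (simp add: power_mult_distrib v e_def s_def distrib_left)
    then show "cardano_applicable a b" using s cardano_applicable_iff[OF nz] by blast
  qed
qed

text \<open>Substituting \<open>\<sigma> = 18 \<rho>\<^sup>3 s\<close> and \<open>6 \<rho> y\<close> for \<open>y\<close>, where \<open>|a|\<^sub>p = \<rho>\<^sup>2\<close> and \<open>|b|\<^sub>p = \<rho>\<^sup>3\<close>.\<close>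

lemma cardano_applicable_iff_unit_parts:
  fixes a b :: "'p::prime_card padic"
  assumes nz: "a \<noteq> 0" "b \<noteq> 0" and eq: "padic_abs a ^ 3 = padic_abs b ^ 2"
  shows "cardano_applicable a b \<longleftrightarrow>
    (\<exists>\<sigma> y. \<sigma> ^ 2 = - 3 * (- 4 * padic_unit_part a ^ 3 - 27 * padic_unit_part b ^ 2) \<and>
       y ^ 3 = 108 * padic_unit_part b + 12 * \<sigma>)"
proof -
  have p1: "(1::rat) < of_nat CARD('p)" using prime_gt_1_nat[OF pcard[where 'p = 'p]] by simp
  obtain k where k: "padic_abs a = of_nat CARD('p) powi k" using padic_abs_eq_powi[OF nz(1)] .
  obtain l where l: "padic_abs b = of_nat CARD('p) powi l" using padic_abs_eq_powi[OF nz(2)] .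
  have "(of_nat CARD('p) :: rat) powi (k * int 3) = of_nat CARD('p) powi (l * int 2)"
    using eq unfolding k l power_int_mult by simp
  then have "k * 3 = l * 2" 
    using p1 power_int_strict_increasing[of "k * 3" "l * 2" "of_nat CARD('p) :: rat"]
      power_int_strict_increasing[of "l * 2" "k * 3" "of_nat CARD('p) :: rat"]
    by (cases "k * 3" "l * 2" rule: linorder_cases) auto
  \<comment> \<open>From \<open>3*k = 2*l\<close> the common exponent \<open>l - k\<close> is read
    off, which provides the square and cube root of the two absolute values.\<close>
  then have "k = 2 * (l - k)" "l = 3 * (l - k)" by presburger+
  then obtain j where j: "k = 2 * j" "l = 3 * j" by blast
  define \<rho> where "\<rho> = (of_nat CARD('p) :: 'p padic) powi j"
  have \<rho>0: "\<rho> \<noteq> 0" by (simp add: \<rho>_def)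
  have a': "padic_unit_part a = a * \<rho> ^ 2" and b': "padic_unit_part b = b * \<rho> ^ 3"
    unfolding padic_unit_part_powi[OF k] padic_unit_part_powi[OF l] j \<rho>_def
    by (simp_all add: power_int_mult mult.commute flip: power_int_power')
  have s_iff: "(18 * \<rho> ^ 3 * s) ^ 2 = - 3 * (- 4 * (a * \<rho> ^ 2) ^ 3 - 27 * (b * \<rho> ^ 3) ^ 2) \<longleftrightarrow>
      s ^ 2 = (a / 3) ^ 3 + (b / 2) ^ 2" for s
  proof -
    have "(18 * \<rho> ^ 3 * s) ^ 2 - (- 3 * (- 4 * (a * \<rho> ^ 2) ^ 3 - 27 * (b * \<rho> ^ 3) ^ 2))
        = 324 * \<rho> ^ 6 * (s ^ 2 - ((a / 3) ^ 3 + (b / 2) ^ 2))"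
      by (simp add: power_divide algebra_simps flip: power_mult)
    then show ?thesis using \<rho>0 by (metis eq_iff_diff_eq_0 mult_eq_0_iff power_eq_0_iff zero_neq_numeral)
  qed
  have y_iff: "(6 * \<rho> * y) ^ 3 = 108 * (b * \<rho> ^ 3) + 12 * (18 * \<rho> ^ 3 * s) \<longleftrightarrow> y ^ 3 = b / 2 + s" for s y
  proof -
    have "(6 * \<rho> * y) ^ 3 - (108 * (b * \<rho> ^ 3) + 12 * (18 * \<rho> ^ 3 * s))
        = 216 * \<rho> ^ 3 * (y ^ 3 - (b / 2 + s))"
      by (simp add: algebra_simps)
    then show ?thesis using \<rho>0 by (metis eq_iff_diff_eq_0 mult_eq_0_iff power_eq_0_iff zero_neq_numeral)
  qed
  have "(\<exists>\<sigma> y. \<sigma> ^ 2 = - 3 * (- 4 * (a * \<rho> ^ 2) ^ 3 - 27 * (b * \<rho> ^ 3) ^ 2) \<and>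
       y ^ 3 = 108 * (b * \<rho> ^ 3) + 12 * \<sigma>) \<longleftrightarrow>
     (\<exists>s y. s ^ 2 = (a / 3) ^ 3 + (b / 2) ^ 2 \<and> y ^ 3 = b / 2 + s)"
    (is "?L \<longleftrightarrow> ?R")
  proof
    assume ?L
    then obtain \<sigma> y where \<sigma>y: "\<sigma> ^ 2 = - 3 * (- 4 * (a * \<rho> ^ 2) ^ 3 - 27 * (b * \<rho> ^ 3) ^ 2)"
       "y ^ 3 = 108 * (b * \<rho> ^ 3) + 12 * \<sigma>" by blast
    have "\<sigma> = 18 * \<rho> ^ 3 * (\<sigma> / (18 * \<rho> ^ 3))" "y = 6 * \<rho> * (y / (6 * \<rho>))"
      using \<rho>0 by simp_all
    then show ?R using \<sigma>y s_iff y_iff by metis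
  next
    assume ?R
    then show ?L using s_iff y_iff by metis
  qed
  then show ?thesis unfolding cardano_applicable_iff[OF nz(1)] a' b' by simp
qed

text \<open>The digit \<open>d0\<close> is tied down only when \<open>D \<noteq> 0\<close>, and
  \<open>\<Delta>0\<close> only if moreover \<open>- 3 * d0\<close> is a residue. The clauses that
  mention them contain these conditions.\<close>

theorem theorem5p1:
  fixes a b D :: "'p::prime_card padic"
    and p :: nat
    and a0 b0 d0 D0 \<Delta>0 :: int
    and u :: "nat \<Rightarrow> int"
  assumes p: "p = CARD('p)" "p > 3"
    and nonzero: "a \<noteq> 0" "b \<noteq> 0"
    and a0: "a0 = int (first_digit (padic_unit_part a))"
    and b0: "b0 = int (first_digit (padic_unit_part b))"
    and D0: "D0 = - 4 * a0 ^ 3 - 27 * b0 ^ 2"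
    and u: "u 1 = 0" "u 2 = - a0" "u 3 = b0"
      "\<And>n. n \<ge> 1 \<Longrightarrow> u (n + 3) = b0 * u n - a0 * u (n + 1)"
    and D: "D = - 4 * (a * of_rat (padic_abs a)) ^ 3 - 27 * (b * of_rat (padic_abs b)) ^ 2"
    and d0: "D \<noteq> 0 \<Longrightarrow> d0 = int (first_digit (padic_unit_part D))"
    and \<Delta>0: "D \<noteq> 0 \<Longrightarrow> QuadRes (int p) (- 3 * d0) \<Longrightarrow>
      \<Delta>0 \<in> {1..int p - 1} \<and> [\<Delta>0 ^ 2 = - 3 * d0] (mod int p)"
  shows "cardano_applicable a b \<longleftrightarrow>
      (padic_abs a ^ 3 < padic_abs b ^ 2 \<and> 3 dvd padic_log_abs b \<and>
        [b0 ^ ((p - 1) div gcd 3 (p - 1)) = 1] (mod int p))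
    \<or> (padic_abs a ^ 3 = padic_abs b ^ 2 \<and> D = 0 \<and>
        [(4 * b0) ^ ((p - 1) div gcd 3 (p - 1)) = 1] (mod int p))
    \<or> (padic_abs a ^ 3 = padic_abs b ^ 2 \<and> 0 < padic_abs D \<and> padic_abs D < 1 \<and>
        2 dvd padic_log_abs D \<and>
        [(- 3 * d0) ^ ((p - 1) div 2) = 1] (mod int p) \<and>
        [(4 * b0) ^ ((p - 1) div gcd 3 (p - 1)) = 1] (mod int p))
    \<or> (padic_abs a ^ 3 = padic_abs b ^ 2 \<and> padic_abs D = 1 \<and>
        \<not> [D0 * (u (p - 2)) ^ 2 = 9 * a0 ^ 2] (mod int p) \<and>
        [(- 3 * d0) ^ ((p - 1) div 2) = 1] (mod int p) \<and>
        [(108 * b0 + 12 * \<Delta>0) ^ ((p - 1) div gcd 3 (p - 1)) = 1] (mod int p))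
    \<or> (padic_abs a ^ 3 > padic_abs b ^ 2 \<and> 2 dvd padic_log_abs a \<and>
        [(3 * a0) ^ ((p - 1) div 2) = 1] (mod int p))"
proof -

  \<comment> \<open>Residues of the unit parts and power criteria\<close>
  note card = p(2)[unfolded p(1)] and dvd23 = not_card_dvd_2_3[OF p(2)[unfolded p(1)]]
    and abs23 = padic_abs_2_3[OF p(2)[unfolded p(1)]]
  have prime_p: "prime p" by (simp add: p(1))
  have crit3: "(\<exists>t. [t ^ 3 = k] (mod int CARD('p))) \<longleftrightarrow>
      [k ^ ((p - 1) div gcd 3 (p - 1)) = 1] (mod int p)" if "\<not> int CARD('p) dvd k" for k
    using power_residue_iff[OF prime_p, of k 3] that by (simp add: p(1))
  have crit2: "(\<exists>t. [t ^ 2 = k] (mod int CARD('p))) \<longleftrightarrow>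
      [k ^ ((p - 1) div 2) = 1] (mod int p)" if "\<not> int CARD('p) dvd k" for k
    using QuadRes_iff_power[OF prime_p _, of k] that p(2) by (simp add: p(1) QuadRes_def)
  define a' b' where "a' = padic_unit_part a" and "b' = padic_unit_part b"
  have a'1: "padic_abs a' = 1" and b'1: "padic_abs b' = 1"
    using nonzero by (simp_all add: a'_def b'_def padic_abs_unit_part)
  have a'0: "a' \<noteq> 0" using a'1 by auto
  have ra: "padic_abs (a' - of_int a0) < 1" and rb: "padic_abs (b' - of_int b0) < 1"
    using padic_abs_diff_first_digit[of a'] padic_abs_diff_first_digit[of b'] a'1 b'1
    by (simp_all add: a0 b0 a'_def b'_def)
  have nda: "\<not> int CARD('p) dvd a0" and ndb: "\<not> int CARD('p) dvd b0"
    using padic_residue_unit_iff[OF ra] padic_residue_unit_iff[OF rb] a'1 b'1 by simp_all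
  have D': "D = - 4 * a' ^ 3 - 27 * b' ^ 2" by (simp add: D a'_def b'_def padic_unit_part_def)
  have rD: "padic_abs (D - of_int D0) < 1"
    using padic_residue_add[OF padic_residue_scale[OF padic_residue_power[OF ra], of "- 4" 3]
        padic_residue_scale[OF padic_residue_power[OF rb], of "- 27" 2]]
    by (simp add: D' D0)
  \<comment> \<open>Being integral, \<open>D\<close> is zero, nonzero of absolute value below 1, or
    a unit.\<close>
  have D1: "padic_abs D \<le> 1"
    using padic_abs_ultrametric[of "D - of_int D0" "of_int D0"] rD
      padic_abs_of_int_le_1[of D0, where 'p = 'p] by simp
  have abs4: "padic_abs (4 :: 'p padic) = 1" "padic_abs (9 :: 'p padic) = 1" "padic_abs (12 :: 'p padic) = 1"
    using padic_abs_mult[of "2 :: 'p padic" 2] padic_abs_mult[of "3 :: 'p padic" 3]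
      padic_abs_mult[of "2 * 2 :: 'p padic" 3] abs23 by simp_all
  have rb4: "padic_abs (4 * b' - of_int (4 * b0)) < 1"
    using padic_residue_scale[OF rb, of 4] by simp
  have b4: "padic_abs (4 * b') = 1" by (simp add: padic_abs_mult abs4 b'1)
  have cube4: "(\<exists>y. y ^ 3 = 4 * b') \<longleftrightarrow> [(4 * b0) ^ ((p - 1) div gcd 3 (p - 1)) = 1] (mod int p)"
    using padic_unit_root_iff[OF dvd23(2) b4 rb4] crit3 padic_residue_unit_iff[OF rb4] b4 by simp
  have cube27: "(\<exists>y. y ^ 3 = 27 * c) \<longleftrightarrow> (\<exists>y. y ^ 3 = c)" for c :: "'p padic"
  proof
    assume "\<exists>y. y ^ 3 = 27 * c"
    then obtain y where "y ^ 3 = 27 * c" by blast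
    then have "(y / 3) ^ 3 = c" by (simp add: power_divide)
    then show "\<exists>y. y ^ 3 = c" by blast
  next
    assume "\<exists>y. y ^ 3 = c"
    then obtain y where "y ^ 3 = c" by blast
    then have "(3 * y) ^ 3 = 27 * c" by (simp add: power_mult_distrib)
    then show "\<exists>y. y ^ 3 = 27 * c" by blast
  qed
  have rd: "padic_abs (padic_unit_part D - of_int d0) < 1" if "D \<noteq> 0"
    using padic_abs_diff_first_digit[of "padic_unit_part D"] that by (simp add: d0 padic_abs_unit_part)
  have nd3d: "\<not> int CARD('p) dvd - 3 * d0" if "D \<noteq> 0"
    using padic_residue_unit_iff[OF padic_residue_scale[OF rd, of "- 3"]] that
    by (simp add: padic_abs_mult abs23 padic_abs_unit_part)
  \<comment> \<open>The unit \<open>- 3\<close> leaves the valuation of \<open>D\<close> unchanged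
    and multiplies its leading digit by \<open>- 3\<close>.\<close>
  have sqrt: "(\<exists>\<sigma>. \<sigma> ^ 2 = - 3 * D) \<longleftrightarrow>
      2 dvd padic_log_abs D \<and> [(- 3 * d0) ^ ((p - 1) div 2) = 1] (mod int p)" if "D \<noteq> 0"
  proof -
    have m3: "padic_abs (- 3 :: 'p padic) = 1" using abs23 by simp
    have "padic_abs (padic_unit_part (- 3 * D) - of_int (- 3 * d0)) < 1"
      using padic_residue_scale[OF rd[OF that], of "- 3"] padic_log_abs_mult_unit(2)[OF m3, of D] by simp
    from padic_root_iff[OF dvd23(1) _ this] show ?thesis
      using that crit2[OF nd3d[OF that]] padic_log_abs_mult_unit(1)[OF m3, of D] by simp
  qed
  consider (lt) "padic_abs a ^ 3 < padic_abs b ^ 2" | (eq) "padic_abs a ^ 3 = padic_abs b ^ 2"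
    | (gt) "padic_abs b ^ 2 < padic_abs a ^ 3" by linarith
  then show ?thesis
  proof cases

    \<comment> \<open>The term in \<open>b\<close> dominates\<close>
    case lt
    have "cardano_applicable a b \<longleftrightarrow> 3 dvd padic_log_abs b \<and>
        [b0 ^ ((p - 1) div gcd 3 (p - 1)) = 1] (mod int p)"
      using cardano_applicable_iff_cube[OF card nonzero lt]
        padic_root_iff[OF dvd23(2) nonzero(2) rb[unfolded b'_def]] crit3[OF ndb] by simp
    then show ?thesis using lt by simp
  next

    \<comment> \<open>The term in \<open>a\<close> dominates\<close>
    case gt
    have r3a: "padic_abs (padic_unit_part (3 * a) - of_int (3 * a0)) < 1"
      using padic_residue_scale[OF ra, of 3] padic_log_abs_mult_unit(2)[OF abs23(2), of a]
      by (simp add: a'_def)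
    have "\<not> int CARD('p) dvd 3 * a0"
      using padic_residue_unit_iff[OF r3a] padic_abs_unit_part[of "3 * a"] nonzero by simp
    then have "cardano_applicable a b \<longleftrightarrow> 2 dvd padic_log_abs a \<and>
        [(3 * a0) ^ ((p - 1) div 2) = 1] (mod int p)"
      using cardano_applicable_iff_square[OF card nonzero(1) gt]
        padic_root_iff[OF dvd23(1) _ r3a] nonzero padic_log_abs_mult_unit(1)[OF abs23(2), of a] crit2
      by simp
    then show ?thesis using gt by simp
  next

    \<comment> \<open>Both terms have the same size\<close>
    case eq
    have H: "cardano_applicable a b \<longleftrightarrow> (\<exists>\<sigma> y. \<sigma> ^ 2 = - 3 * D \<and> y ^ 3 = 108 * b' + 12 * \<sigma>)"
      using cardano_applicable_iff_unit_parts[OF nonzero eq] by (simp only: D' a'_def b'_def)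
    consider (zero) "D = 0" | (small) "D \<noteq> 0" "padic_abs D < 1" | (unit) "padic_abs D = 1"
      using D1 by linarith
    then show ?thesis
    proof cases
      case zero
      \<comment> \<open>Here \<open>\<sigma> = 0\<close>, and \<open>108 * b'\<close> is
        \<open>4 * b'\<close> times the cube 27.\<close>
      have "cardano_applicable a b \<longleftrightarrow> (\<exists>y. y ^ 3 = 27 * (4 * b'))"
        unfolding H zero by simp
      then have "cardano_applicable a b \<longleftrightarrow> [(4 * b0) ^ ((p - 1) div gcd 3 (p - 1)) = 1] (mod int p)"
        unfolding cube27 cube4 .
      then show ?thesis using eq zero by simp
    next
      case small
      have "(\<exists>y. y ^ 3 = 108 * b' + 12 * \<sigma>) \<longleftrightarrow> (\<exists>y. y ^ 3 = 4 * b')" if "\<sigma> ^ 2 = - 3 * D" for \<sigma>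
      proof -
        \<comment> \<open>This is the factor in
          \<open>108*b' + 12*\<sigma> = 27 * (4*b' * x)\<close>; it is near 1 because
          \<open>|\<sigma>|^2 = |D| < 1\<close>.\<close>
        define x where "x = 1 + \<sigma> / (9 * b')"
        have "padic_abs \<sigma> ^ 2 = padic_abs D"
          unfolding padic_abs_power[symmetric] that by (simp add: padic_abs_mult abs23)
        then have "padic_abs \<sigma> ^ 2 < 1" using small by simp
        then have "padic_abs \<sigma> < 1" by (simp add: power_less_one_iff)
        then have "padic_abs (x - 1) < 1"
          by (simp add: x_def padic_abs_divide padic_abs_mult abs4 b'1)
        moreover have "b' \<noteq> 0" using b'1 by auto
        then have "108 * b' + 12 * \<sigma> = 27 * (4 * b' * x)" by (simp add: x_def field_simps)
        ultimately show ?thesis using cube27 padic_root_mult_near_1_iff[OF dvd23(2)] by metis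
      qed
      then have "cardano_applicable a b \<longleftrightarrow> (\<exists>\<sigma>. \<sigma> ^ 2 = - 3 * D) \<and> (\<exists>y. y ^ 3 = 4 * b')"
        unfolding H by blast
      then show ?thesis using eq small padic_abs_pos[OF small(1)] sqrt cube4 by simp
    next
      case unit
      then have Dnz: "D \<noteq> 0" by auto
      have log0: "padic_log_abs D = 0" using padic_log_abs_eq[of D 0] unit by simp
      have unitD: "padic_unit_part D = D" by (simp add: padic_unit_part_def unit)
      have dD: "[D0 = d0] (mod int CARD('p))"
        using padic_residue_cong_iff[OF rD] rd[OF Dnz] by (simp add: unitD)
      have ndD: "\<not> int CARD('p) dvd D0" using padic_residue_unit_iff[OF rD] unit by simp
      have main: "cardano_applicable a b \<longleftrightarrow> [(108 * b0 + 12 * \<Delta>0) ^ ((p - 1) div gcd 3 (p - 1)) = 1] (mod int p)"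
        and neq: "[(108 * b0 + 12 * \<Delta>0) ^ ((p - 1) div gcd 3 (p - 1)) = 1] (mod int p) \<Longrightarrow>
           \<not> [D0 * (u (p - 2)) ^ 2 = 9 * a0 ^ 2] (mod int p)"
        if QR: "[(- 3 * d0) ^ ((p - 1) div 2) = 1] (mod int p)"
      proof -
        have "QuadRes (int p) (- 3 * d0)"
          using QR crit2[OF nd3d[OF Dnz]] by (simp add: QuadRes_def p(1))
        then have \<Delta>: "\<Delta>0 \<in> {1..int p - 1}" "[\<Delta>0 ^ 2 = - 3 * d0] (mod int CARD('p))"
          using \<Delta>0[OF Dnz] by (simp_all add: p(1))
        then have "\<not> int CARD('p) dvd \<Delta>0" by (auto simp: p(1) dest: zdvd_imp_le)
        then have \<Delta>1: "padic_abs (of_int \<Delta>0 :: 'p padic) = 1" by (simp add: padic_abs_of_int_eq_1_iff)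
        have "padic_abs (- 3 * D - of_int (- 3 * d0)) < 1"
          using padic_residue_scale[OF rd[OF Dnz], of "- 3"] by (simp add: unitD)
        \<comment> \<open>As \<open>D\<close> is its own unit part, \<open>\<Delta>0\<close> is a
          square root of \<open>- 3 * D\<close> modulo \<open>p\<close>; being a unit, it lifts to
          \<open>\<sigma>\<close>.\<close>
        then have "padic_abs (- 3 * D - of_int (\<Delta>0 ^ 2)) < 1"
          using padic_residue_cong_iff \<Delta>(2) cong_sym by blast
        then obtain \<sigma> where \<sigma>: "\<sigma> ^ 2 = - 3 * D" "padic_abs (\<sigma> - of_int \<Delta>0) < 1"
          using padic_hensel_power[OF dvd23(1) \<Delta>1] by auto
        \<comment> \<open>The two signs of the square root give these candidates. The terms in
          \<open>b'\<close> cancel in \<open>X * Y + 432 * 4 * a'^3\<close>, so the product is a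
          cube.\<close>
        define X Y where "X = 108 * b' + 12 * \<sigma>" and "Y = 108 * b' + 12 * (- \<sigma>)"
        have "X * Y = 11664 * b' ^ 2 - 144 * \<sigma> ^ 2"
          by (simp add: X_def Y_def algebra_simps power2_eq_square)
        also have "\<dots> = (- 12 * a') ^ 3"
          unfolding \<sigma>(1) D' by (simp add: power_mult_distrib)
        finally have XY: "X * Y = (- 12 * a') ^ 3" .
        have "padic_abs (- 12 * a') = 1" by (simp add: padic_abs_mult abs4 a'1)
        then have XY1: "padic_abs X * padic_abs Y = 1"
          unfolding padic_abs_mult[symmetric] XY padic_abs_power by simp
        have rX: "padic_abs (X - of_int (108 * b0 + 12 * \<Delta>0)) < 1"
          unfolding X_def
          using padic_residue_add[OF padic_residue_scale[OF rb, of 108] padic_residue_scale[OF \<sigma>(2), of 12]]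
          by simp
        have le: "padic_abs (108 * b' + 12 * c) \<le> 1" if "padic_abs c \<le> 1" for c
        proof -
          have "padic_abs (108 * b') \<le> 1 * 1"
            unfolding padic_abs_mult using b'1 padic_abs_of_int_le_1[of 108, where 'p = 'p]
            by (intro mult_mono) auto
          moreover have "padic_abs (12 * c) \<le> 1" using that by (simp add: padic_abs_mult abs4)
          ultimately show ?thesis using padic_abs_ultrametric[of "108 * b'" "12 * c"] by simp
        qed
        have "padic_abs \<sigma> = 1" using padic_abs_eqI[of \<sigma> "of_int \<Delta>0"] \<sigma>(2) unfolding \<Delta>1 .
        then have X_le: "padic_abs X \<le> 1" and Y_le: "padic_abs Y \<le> 1"
          unfolding X_def Y_def by (simp_all only: le padic_abs_minus order_refl)
        \<comment> \<open>Two integral factors whose absolute values have product 1 are units, so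
          the unit root criterion applies to \<open>X\<close>.\<close>
        have "padic_abs X * padic_abs Y \<le> padic_abs X"
          using Y_le padic_abs_nonneg by (rule mult_left_le)
        then have X1: "padic_abs X = 1" using X_le XY1 by linarith
        have ndX: "\<not> int CARD('p) dvd 108 * b0 + 12 * \<Delta>0"
          using padic_residue_unit_iff[OF rX] X1 by blast
        have cubeX: "(\<exists>y. y ^ 3 = X) \<longleftrightarrow> [(108 * b0 + 12 * \<Delta>0) ^ ((p - 1) div gcd 3 (p - 1)) = 1] (mod int p)"
          unfolding padic_unit_root_iff[OF dvd23(2) X1 rX] by (rule crit3[OF ndX])
        \<comment> \<open>Because \<open>X * Y\<close> is a nonzero cube, \<open>Y\<close> being a
          cube makes \<open>X\<close> one; hence the sign of \<open>\<sigma>\<close> is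
          immaterial.\<close>
        have YX: "\<exists>y. y ^ 3 = X" if "y ^ 3 = Y" for y
        proof -
          have "Y \<noteq> 0" using XY1 by auto
          then have "(- 12 * a' / y) ^ 3 = X"
            unfolding power_divide that XY[symmetric] by simp
          then show ?thesis by blast
        qed
        have "(\<exists>\<sigma> y. \<sigma> ^ 2 = - 3 * D \<and> y ^ 3 = 108 * b' + 12 * \<sigma>) \<longleftrightarrow> (\<exists>y. y ^ 3 = X)"
        proof
          assume "\<exists>\<sigma> y. \<sigma> ^ 2 = - 3 * D \<and> y ^ 3 = 108 * b' + 12 * \<sigma>"
          then obtain \<tau> y where \<tau>: "\<tau> ^ 2 = - 3 * D" "y ^ 3 = 108 * b' + 12 * \<tau>" by blast
          then have "\<tau> = \<sigma> \<or> \<tau> = - \<sigma>" unfolding \<sigma>(1)[symmetric] power2_eq_iff by blast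
          then show "\<exists>y. y ^ 3 = X" using \<tau>(2) YX X_def Y_def by blast
        qed (use \<sigma>(1) X_def in blast)
        then show "cardano_applicable a b \<longleftrightarrow>
            [(108 * b0 + 12 * \<Delta>0) ^ ((p - 1) div gcd 3 (p - 1)) = 1] (mod int p)"
          unfolding H cubeX .
        assume "[(108 * b0 + 12 * \<Delta>0) ^ ((p - 1) div gcd 3 (p - 1)) = 1] (mod int p)"
        then obtain t where t: "[t ^ 3 = 108 * b0 + 12 * \<Delta>0] (mod int CARD('p))"
          using crit3[OF ndX] by blast
        have "[- 3 * d0 = - 3 * D0] (mod int CARD('p))"
          using dD by (intro cong_scalar_left) (rule cong_sym)
        then have "[\<Delta>0 ^ 2 = - 3 * D0] (mod int CARD('p))" using \<Delta>(2) by (rule cong_trans[rotated])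
        then show "\<not> [D0 * (u (p - 2)) ^ 2 = 9 * a0 ^ 2] (mod int p)"
          using recurrence_not_cong[OF card u nda ndb _ _ t] ndD unfolding D0 p(1) by blast
      qed
      \<comment> \<open>Applicability makes \<open>- 3 * D\<close> a square, which provides the
        residue condition under which \<open>main\<close> and \<open>neq\<close> were
        proved.\<close>
      have "cardano_applicable a b \<Longrightarrow> [(- 3 * d0) ^ ((p - 1) div 2) = 1] (mod int p)"
        using sqrt[OF Dnz] unfolding H by blast
      then have "cardano_applicable a b \<longleftrightarrow> \<not> [D0 * (u (p - 2)) ^ 2 = 9 * a0 ^ 2] (mod int p) \<and>
          [(- 3 * d0) ^ ((p - 1) div 2) = 1] (mod int p) \<and>
          [(108 * b0 + 12 * \<Delta>0) ^ ((p - 1) div gcd 3 (p - 1)) = 1] (mod int p)"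
        using main neq by blast
      then show ?thesis using eq unit Dnz by simp
    qed
  qed
qed

end
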